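(* Let $V$, $\phi_k$, $\sigma^\infty$, $E_n^1$, $\operatorname{Dom}E_n^1$, $E_\infty^1$, $\operatorname{Dom}E_\infty^1$ and the convergences $\xrightarrow{2}$, $\overset{2}{\rightharpoonup}$ be as in the context. (i) (Compactness) If $(\epsilon^n)_{n\ge 1}\subset \ell^2(\mathbb{N})$ is a sequence such that $E_n^1(\epsilon^n)$ is uniformly bounded in $n$, then $\|\epsilon^n\|_{\ell^2(\mathbb{N})}$ is uniformly bounded in $n$. (ii) ($\Gamma$-convergence) For every $(\epsilon,\eta)\in\operatorname{Dom}E_\infty^1$: (a) for all sequences $(\epsilon^n)$ with $\epsilon^n\in\operatorname{Dom}E_n^1$ for every $n$ and $\epsilon^n\overset{2}{\rightharpoonup}(\epsilon,\eta)$, one has $$\liminf_{n\to\infty}E_n^1(\epsilon^n)\ \ge\ E_\infty^1(\epsilon,\eta);$$ (b) there exists a sequence $(\epsilon^n)$ with $\epsilon^n\in\operatorname{Dom}E_n^1$ for every $n$ and $\epsilon^n\xrightarrow{2}(\epsilon,\eta)$ such that $$\limsup_{n\to\infty}E_n^1(\epsilon^n)\ \le\ E_\infty^1(\epsilon,\eta).$$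
   Context: $\mathbb{N}=\{1,2,3,\dots\}$ and $\ell^2(\mathbb{N})$ is the space of real square-summable sequences with its usual inner product $(\cdot,\cdot)_{\ell^2(\mathbb{N})}$. **Assumptions on the potential.** $V:\mathbb{R}\to[0,+\infty]$ satisfies: - $V:\mathbb{R}\setminus\{0\}\to(0,+\infty)$ is even and $C^2$; - $V(x)\to V(0)=+\infty$ as $x\downarrow0$ or $x\uparrow 0$; - for each $x\in(0,+\infty)$ there exists $\lambda(x)>0$ such that $\inf_{(0,x)}V''\ge\lambda(x)$; - $V(x),V'(x)\to0$ as $|x|\to\infty$, and there exist $a>\tfrac32$ and constants $c_\delta$ such that for any $\delta>0$, $V''(x)\le c_\delta|x|^{-a-2}$ for all $x\in\mathbb{R}\setminus(-\delta,\delta)$. **Energy $E_n^1$.** For $n\ge1$ let $$\operatorname{Dom}E_n^1:=\Big\{\epsilon\in[-1,n]^n : \sum_{i=1}^n\epsilon(i)=0\Big\},\qquad E_n^1(\epsilon):=\sum_{k=1}^n\sum_{j=0}^{n-k}\Big[V\Big(k+\sum_{l=j+1}^{j+k}\epsilon(l)\Big)-V(k)\Big]\in(-\infty,+\infty].$$ A vector $\epsilon\in\operatorname{Dom}E_n^1$ is identified with the element of $\ell^2(\mathbb{N})$ obtained by setting $\epsilon(i)=0$ for $i>n$, and $E_n^1$ is extended to all of $\ell^2(\mathbb{N})$ by the value $+\infty$ outside (the image of) $\operatorname{Dom}E_n^1$. **Convergence.** For $\epsilon^n\in\operatorname{Dom}E_n^1$ define the two half sequences in $\ell^2(\mathbb{N})$: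 $\epsilon^{n,1/2}(i):=\epsilon^n(i)$ for $i=1,\dots,\lceil n/2\rceil$ and $0$ otherwise; $\overleftarrow{\epsilon}^{\,n,1/2}(i):=\epsilon^n(n+1-i)$ for $i=1,\dots,\lceil n/2\rceil$ and $0$ otherwise. For $(\epsilon,\eta)\in\ell^2(\mathbb{N})\times\ell^2(\mathbb{N})$ write $\epsilon^n\xrightarrow{2}(\epsilon,\eta)$ if $\epsilon^{n,1/2}\to\epsilon$ and $\overleftarrow{\epsilon}^{\,n,1/2}\to\eta$ strongly in $\ell^2(\mathbb{N})$ as $n\to\infty$, and $\epsilon^n\overset{2}{\rightharpoonup}(\epsilon,\eta)$ if both convergences hold weakly in $\ell^2(\mathbb{N})$. **Limit energy.** For $k\ge1$ let $\phi_k(y):=V(k+y)-V(k)-V'(k)y$ (with value $+\infty$ at $y=-k$), and let $\sigma^\infty(i):=\sum_{k=i+1}^\infty(k-i)|V'(k)|$ for $i\ge1$; since $V$ is even, positive and $C^2$ on $\mathbb{R}\setminus\{0\}$, with $V(x)\to V(0)=+\infty$ as $x\to0$, with $\inf_{(0,x)}V''\ge\lambda(x)>0$ for every $x>0$, with $V(x),V'(x)\to0$ as $|x|\to\infty$, and with $V''(x)\le c_\delta|x|^{-a-2}$ for all $\delta>0$ and $x\in\mathbb{R}\setminus(-\delta,\delta)$, where $a>\tfrac32$, one has $\sigma^\infty\in\ell^2(\mathbb{N})$ and $\phi_k\ge0$ on $[-k,\infty)$. Set $$\operatorname{Dom}E_\infty^1:=\big\{(\epsilon,\eta)\in\ell^2(\mathbb{N})\times\ell^2(\mathbb{N}):\epsilon(i)\ge-1,\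 \eta(i)\ge-1\ \ \forall i\ge1\big\},$$ $$E_\infty^1(\epsilon,\eta):=\sum_{k=1}^\infty\sum_{j=0}^\infty\phi_k\Big(\sum_{l=j+1}^{k+j}\epsilon(l)\Big)+\sum_{k=1}^\infty\sum_{j=0}^\infty\phi_k\Big(\sum_{l=j+1}^{k+j}\eta(l)\Big)+(\sigma^\infty,\epsilon+\eta)_{\ell^2(\mathbb{N})}\in(-\infty,+\infty].$$ *)

theory Defs
  imports "HOL-Analysis.Analysis"
begin

section \<open>The sequence space\<close>

text \<open>
  Real square-summable sequences are indexed by \<open>1, 2, 3, \<dots>\<close>. They are represented by
  functions on \<^typ>\<open>nat\<close> whose unused entry at index \<open>0\<close> is \<open>0\<close>, so that sequences
  correspond one-to-one to elements of \<open>ell2\<close> and sums over all of \<^typ>\<open>nat\<close> are sums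
  over \<open>i \<ge> 1\<close>.
\<close>

definition ell2 :: "(nat \<Rightarrow> real) set" where
  "ell2 = {x. x 0 = 0 \<and> summable (\<lambda>i. (x i)\<^sup>2)}"

definition ell2_inner :: "(nat \<Rightarrow> real) \<Rightarrow> (nat \<Rightarrow> real) \<Rightarrow> real" where
  "ell2_inner x y = (\<Sum>i. x i * y i)"

definition ell2_norm :: "(nat \<Rightarrow> real) \<Rightarrow> real" where
  "ell2_norm x = sqrt (ell2_inner x x)"

definition strong_conv :: "(nat \<Rightarrow> nat \<Rightarrow> real) \<Rightarrow> (nat \<Rightarrow> real) \<Rightarrow> bool" where
  "strong_conv X x \<longleftrightarrow> (\<lambda>n. ell2_norm (\<lambda>i. X n i - x i)) \<longlonglongrightarrow> 0"

definition weak_conv :: "(nat \<Rightarrow> nat \<Rightarrow> real) \<Rightarrow> (nat \<Rightarrow> real) \<Rightarrow> bool" where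
  "weak_conv X x \<longleftrightarrow> (\<forall>y\<in>ell2. (\<lambda>n. ell2_inner (X n) y) \<longlonglongrightarrow> ell2_inner x y)"


section \<open>The potential\<close>

text \<open>
  The potential takes the value \<open>\<infinity>\<close> at \<open>0\<close>. Its derivatives, used only away from \<open>0\<close>, are
  those of its real-valued version.
\<close>

definition V1 :: "(real \<Rightarrow> ereal) \<Rightarrow> real \<Rightarrow> real" where
  "V1 V = deriv (\<lambda>x. real_of_ereal (V x))"

definition V2 :: "(real \<Rightarrow> ereal) \<Rightarrow> real \<Rightarrow> real" where
  "V2 V = deriv (V1 V)"

text \<open>The infimum of \<open>V''\<close> is taken in \<^typ>\<open>ereal\<close>, so that it may a priori be \<open>-\<infinity>\<close>.\<close>

definition admissible_potential :: "(real \<Rightarrow> ereal) \<Rightarrow> bool" where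
  "admissible_potential V \<longleftrightarrow>
     (\<forall>x. x \<noteq> 0 \<longrightarrow> 0 < V x \<and> V x < \<infinity>) \<and>
     (\<forall>x. V (- x) = V x) \<and>
     (\<lambda>x. real_of_ereal (V x)) differentiable_on (- {0}) \<and>
     V1 V differentiable_on (- {0}) \<and>
     continuous_on (- {0}) (V2 V) \<and>
     V 0 = \<infinity> \<and> (V \<longlongrightarrow> V 0) (at 0) \<and>
     (\<forall>x>0. \<exists>lam>0. ereal lam \<le> (INF y\<in>{0<..<x}. ereal (V2 V y))) \<and>
     (V \<longlongrightarrow> 0) at_infinity \<and> (V1 V \<longlongrightarrow> 0) at_infinity \<and>
     (\<exists>a>3/2. \<exists>c :: real \<Rightarrow> real. \<forall>\<delta>>0. \<forall>x\<in>- {-\<delta><..<\<delta>}.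
        V2 V x \<le> c \<delta> * \<bar>x\<bar> powr (- a - 2))"


section \<open>The finite energies\<close>

definition Dom_E :: "nat \<Rightarrow> (nat \<Rightarrow> real) set" where
  "Dom_E n = {\<epsilon>\<in>ell2. (\<forall>i\<in>{1..n}. \<epsilon> i \<in> {-1..real n}) \<and> (\<Sum>i=1..n. \<epsilon> i) = 0
                \<and> (\<forall>i>n. \<epsilon> i = 0)}"

definition E :: "(real \<Rightarrow> ereal) \<Rightarrow> nat \<Rightarrow> (nat \<Rightarrow> real) \<Rightarrow> ereal" where
  "E V n \<epsilon> =
     (if \<epsilon> \<in> Dom_E n
      then \<Sum>k=1..n. \<Sum>j=0..n-k. V (real k + (\<Sum>l=j+1..j+k. \<epsilon> l)) - V (real k)
      else \<infinity>)"


section \<open>Convergence of configurations\<close>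

definition left_half :: "nat \<Rightarrow> (nat \<Rightarrow> real) \<Rightarrow> nat \<Rightarrow> real" where
  "left_half n \<epsilon> i = (if i \<in> {1..nat \<lceil>real n / 2\<rceil>} then \<epsilon> i else 0)"

definition right_half :: "nat \<Rightarrow> (nat \<Rightarrow> real) \<Rightarrow> nat \<Rightarrow> real" where
  "right_half n \<epsilon> i = (if i \<in> {1..nat \<lceil>real n / 2\<rceil>} then \<epsilon> (n + 1 - i) else 0)"

definition strong_conv2 ::
    "(nat \<Rightarrow> nat \<Rightarrow> real) \<Rightarrow> (nat \<Rightarrow> real) \<times> (nat \<Rightarrow> real) \<Rightarrow> bool" where
  "strong_conv2 X = (\<lambda>(\<epsilon>, \<eta>).
     strong_conv (\<lambda>n. left_half n (X n)) \<epsilon> \<and> strong_conv (\<lambda>n. right_half n (X n)) \<eta>)"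

definition weak_conv2 ::
    "(nat \<Rightarrow> nat \<Rightarrow> real) \<Rightarrow> (nat \<Rightarrow> real) \<times> (nat \<Rightarrow> real) \<Rightarrow> bool" where
  "weak_conv2 X = (\<lambda>(\<epsilon>, \<eta>).
     weak_conv (\<lambda>n. left_half n (X n)) \<epsilon> \<and> weak_conv (\<lambda>n. right_half n (X n)) \<eta>)"


section \<open>The limit energy\<close>

text \<open>Since \<open>V 0 = \<infinity>\<close>, the next definition gives \<open>\<phi> V k (- k) = \<infinity>\<close> for \<open>k \<ge> 1\<close>.\<close>

definition \<phi> :: "(real \<Rightarrow> ereal) \<Rightarrow> nat \<Rightarrow> real \<Rightarrow> ereal" where
  "\<phi> V k y = V (real k + y) - V (real k) - ereal (V1 V (real k) * y)"

text \<open>The summation index \<open>m\<close> stands for \<open>k - i - 1\<close>.\<close>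

definition \<sigma>_inf :: "(real \<Rightarrow> ereal) \<Rightarrow> nat \<Rightarrow> real" where
  "\<sigma>_inf V i = (if i = 0 then 0 else \<Sum>m. real (m + 1) * \<bar>V1 V (real (i + 1 + m))\<bar>)"

definition Dom_E_inf :: "((nat \<Rightarrow> real) \<times> (nat \<Rightarrow> real)) set" where
  "Dom_E_inf = {(\<epsilon>, \<eta>). \<epsilon> \<in> ell2 \<and> \<eta> \<in> ell2 \<and> (\<forall>i\<ge>1. \<epsilon> i \<ge> -1 \<and> \<eta> i \<ge> -1)}"

text \<open>
  The index \<open>k\<close> is shifted by one. On \<open>Dom_E_inf\<close> all terms of the double series are
  nonnegative, so that these converge in \<^typ>\<open>ereal\<close>.
\<close>

definition E_inf :: "(real \<Rightarrow> ereal) \<Rightarrow> (nat \<Rightarrow> real) \<times> (nat \<Rightarrow> real) \<Rightarrow> ereal" where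
  "E_inf V = (\<lambda>(\<epsilon>, \<eta>).
     (\<Sum>k. \<Sum>j. \<phi> V (Suc k) (\<Sum>l=j+1..Suc k + j. \<epsilon> l)) +
     (\<Sum>k. \<Sum>j. \<phi> V (Suc k) (\<Sum>l=j+1..Suc k + j. \<eta> l)) +
     ereal (ell2_inner (\<sigma>_inf V) (\<lambda>i. \<epsilon> i + \<eta> i)))"

end

theory Submission
  imports Defs "HOL-Library.Discrete_Functions"
begin

text \<open>
  Expand \<open>V\<close> around the equilibrium spacings \<open>k\<close>. The linear part of the energy is the sum of \<open>V'(k)\<close>
  times all window sums of length \<open>k\<close>.
  Since \<open>\<epsilon>\<close> has mean zero, it is unchanged when a constant is subtracted from its coefficients;
  what remains acts only near the two ends and converges to \<open>\<sigma>\<^sup>\<infinity>\<close> in \<open>\<ell>\<^sup>2\<close>. The rest of the energy is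
  a sum of nonnegative convex terms \<open>\<phi>\<^sub>k\<close>.

  Compactness: \<open>\<phi>\<^sub>1\<close> grows at least like \<open>min y\<^sup>2 \<bar>y\<bar>\<close>, and the boundary force, being nonnegative, only
  has to be balanced where \<open>\<epsilon> \<le> 0\<close>, where \<open>\<epsilon> \<ge> -1\<close> makes \<open>\<phi>\<^sub>1\<close> quadratic. Lower bound: keep finitely many
  terms at either end and use continuity of \<open>\<phi>\<^sub>k\<close>; the boundedness needed for the linear part comes from
  the energy bound. Upper bound: cut \<open>\<epsilon>\<close> and \<open>\<eta>\<close> off at distance about \<open>sqrt n\<close> from the ends, restore
  mean zero by a constant in the middle, and bound the new terms by \<open>\<phi>\<^sub>k y \<le> C k powr (-a) * (y / k)\<^sup>2\<close>.
\<close>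

section \<open>The potential\<close>

text \<open>In the bulk the linear coefficient is a constant of order one, so its norm over
  \<open>{1..n}\<close> grows like \<open>sqrt n\<close> and no square-summability bound on
  \<open>\<epsilon>\<close> controls it; hence the use of mean zero. For each \<open>k\<close> the
  constant removed is the largest window count, attained at the centre. The remainder therefore has
  one sign, the same as \<open>V'\<close>, so the force is nonnegative and vanishes at the centre,
  where the two halves meet.

  The threshold \<open>3/2\<close> comes from the force: \<open>\<bar>V' x\<bar>\<close> is at most
  of order \<open>x powr (-a-1)\<close>, which suggests order \<open>i powr (1-a)\<close> for
  \<open>\<sigma>_inf V i\<close>, and that is square-summable when \<open>a > 3/2\<close>.

  In the upper bound the danger is the singularity. Windows inside a boundary layer reproduce terms
  of the limit energy exactly, so infinite values there need no estimate. Any other window of length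
  \<open>k\<close> must have sum at least \<open>- k / 2\<close> before the quadratic bound applies.
  Short windows meet little mass; for long ones bounded mass suffices, since it gives a sum of order
  \<open>sqrt k\<close>.

  Any cutoff with \<open>m\<close> tending to infinity and \<open>m / n\<close> to \<open>0\<close>
  would balance truncation against compensation; \<open>sqrt n\<close> is a convenient
  choice.\<close>

context
  fixes V :: "real \<Rightarrow> ereal"
  assumes adm: "admissible_potential V"
begin

lemma potential_ereal: "x \<noteq> 0 \<Longrightarrow> V x = ereal (real_of_ereal (V x))"
proof -
  assume "x \<noteq> 0"
  then have "0 < V x" "V x < \<infinity>"
    using adm unfolding admissible_potential_def by blast+
  then show ?thesis by (cases "V x") auto
qed

lemma potential_at_0: "V 0 = \<infinity>"
  using adm unfolding admissible_potential_def by simp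

text \<open>Continuity is meant in the extended reals and includes the point \<open>0\<close>; this
  lets \<open>phi_tendsto\<close> cover windows whose limiting sum is \<open>- k\<close>.\<close>

lemma isCont_potential: "isCont V x"
proof (cases "x = 0")
  case True
  then show ?thesis
    using adm unfolding admissible_potential_def isCont_def by blast
next
  case False
  have "(\<lambda>x. real_of_ereal (V x)) differentiable (at x within - {0})"
    using adm False unfolding admissible_potential_def differentiable_on_def by auto
  then have "continuous (at x within - {0}) (\<lambda>x. real_of_ereal (V x))"
    by (rule differentiable_imp_continuous_within)
  then have "isCont (\<lambda>x. real_of_ereal (V x)) x"
    using False by (simp add: at_within_open[of x "- {0}"] open_Compl)
  then have "((\<lambda>x. ereal (real_of_ereal (V x))) \<longlongrightarrow> ereal (real_of_ereal (V x))) (at x)"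
    unfolding isCont_def by simp
  then have "(V \<longlongrightarrow> ereal (real_of_ereal (V x))) (at x)"
  proof (rule Lim_transform_eventually)
    have "\<forall>\<^sub>F y in at x. y \<in> - {0}"
      by (rule eventually_at_in_open') (use False in auto)
    then show "\<forall>\<^sub>F y in at x. ereal (real_of_ereal (V y)) = V y"
      by eventually_elim (use potential_ereal in auto)
  qed
  then show ?thesis
    unfolding isCont_def using potential_ereal[OF False] by simp
qed

lemma potential_has_derivative:
  assumes "x \<noteq> 0"
  shows "((\<lambda>x. real_of_ereal (V x)) has_real_derivative V1 V x) (at x)"
proof -
  have "(\<lambda>x. real_of_ereal (V x)) differentiable (at x within - {0})"
    using adm assms unfolding admissible_potential_def differentiable_on_def by auto
  then have "(\<lambda>x. real_of_ereal (V x)) differentiable (at x)"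
    using assms by (simp add: at_within_open[of x "- {0}"] open_Compl)
  then show ?thesis
    unfolding V1_def by (simp add: DERIV_deriv_iff_real_differentiable)
qed

lemma V1_has_derivative:
  assumes "x \<noteq> 0"
  shows "(V1 V has_real_derivative V2 V x) (at x)"
proof -
  have "V1 V differentiable (at x within - {0})"
    using adm assms unfolding admissible_potential_def differentiable_on_def by auto
  then have "V1 V differentiable (at x)"
    using assms by (simp add: at_within_open[of x "- {0}"] open_Compl)
  then show ?thesis
    unfolding V2_def by (simp add: DERIV_deriv_iff_real_differentiable)
qed

section \<open>Sign and decay of the derivatives of \<open>V\<close>\<close>

lemma V2_lower_bound:
  assumes "x > 0"
  obtains lam where "lam > 0" "\<And>y. 0 < y \<Longrightarrow> y < x \<Longrightarrow> lam \<le> V2 V y"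
proof -
  obtain lam where lam: "lam > 0" "ereal lam \<le> (INF y\<in>{0<..<x}. ereal (V2 V y))"
    using adm assms unfolding admissible_potential_def by blast
  have "lam \<le> V2 V y" if "0 < y" "y < x" for y
  proof -
    have "(INF y\<in>{0<..<x}. ereal (V2 V y)) \<le> ereal (V2 V y)"
      by (rule INF_lower) (use that in auto)
    then show ?thesis using lam(2) by (meson ereal_less_eq(3) order_trans)
  qed
  with lam(1) show ?thesis by (rule that)
qed

lemma V2_pos:
  assumes "x > 0"
  shows "V2 V x > 0"
proof -
  obtain lam where "lam > 0" "\<And>y. 0 < y \<Longrightarrow> y < x + 1 \<Longrightarrow> lam \<le> V2 V y"
    using V2_lower_bound[of "x + 1"] assms by auto
  from this(1) this(2)[of x] assms show ?thesis by linarith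
qed

lemma V1_tendsto_0: "(V1 V \<longlongrightarrow> 0) at_top"
proof -
  have "(V1 V \<longlongrightarrow> 0) at_infinity"
    using adm unfolding admissible_potential_def by simp
  then show ?thesis by (rule filterlim_mono) (auto simp: at_top_le_at_infinity)
qed

text \<open>\<open>V'' > 0\<close> makes \<open>V'\<close> strictly increasing on the positive axis,
  and its limit at infinity is \<open>0\<close>.\<close>

lemma V1_neg:
  assumes "x > 0"
  shows "V1 V x < 0"
proof -
  have mono: "V1 V y < V1 V z" if "0 < y" "y < z" for y z
  proof (rule DERIV_pos_imp_increasing[OF that(2)])
    fix t assume "y \<le> t" "t \<le> z"
    then show "\<exists>D. DERIV (V1 V) t :> D \<and> D > 0"
      using V1_has_derivative[of t] V2_pos[of t] that by auto
  qed
  have "V1 V (x + 1) \<le> 0"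
  proof (rule tendsto_lowerbound[OF V1_tendsto_0])
    show "\<forall>\<^sub>F y in at_top. V1 V (x + 1) \<le> V1 V y"
      using eventually_gt_at_top[of "x + 1"]
      by eventually_elim (use mono[of "x + 1"] assms in \<open>auto intro: less_imp_le\<close>)
  qed simp
  with mono[of x "x + 1"] assms show ?thesis by simp
qed

text \<open>The cutoff \<open>1/2\<close> is the smallest point at which the bound is needed:
  \<open>phi_upper_bound\<close> evaluates \<open>V''\<close> at points no smaller than
  \<open>k / 2\<close> with \<open>k \<ge> 1\<close>.\<close>

lemma V2_decay:
  obtains a c where "a > 3/2" "c > 0" "\<And>x. x \<ge> 1/2 \<Longrightarrow> V2 V x \<le> c * x powr (- a - 2)"
proof -
  obtain a c where a: "a > 3/2"
    and c: "\<And>\<delta> x. \<delta> > 0 \<Longrightarrow> x \<in> - {-\<delta><..<\<delta>} \<Longrightarrow> V2 V x \<le> c \<delta> * \<bar>x\<bar> powr (- a - 2)"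
    using adm unfolding admissible_potential_def by blast
  have c': "V2 V x \<le> c (1/2) * x powr (- a - 2)" if "x \<ge> 1/2" for x
    using c[of "1/2" x] that by auto
  have "0 < c (1/2)"
    using c'[of 1] V2_pos[of 1] by simp
  with a c' show ?thesis by (intro that[of a "c (1/2)"]) auto
qed

text \<open>This is the bound on \<open>V''\<close> integrated from \<open>x\<close> to infinity.
  The integral is avoided by comparing primitives: \<open>g\<close> is nonincreasing and tends to
  \<open>0\<close>, hence is nonnegative.\<close>

lemma V1_decay:
  obtains a C where "a > 3/2" "C > 0" "\<And>x. x \<ge> 1 \<Longrightarrow> \<bar>V1 V x\<bar> \<le> C * x powr (- a - 1)"
proof -
  obtain a c where a: "a > 3/2" and c: "c > 0"
    and V2: "\<And>x. x \<ge> 1/2 \<Longrightarrow> V2 V x \<le> c * x powr (- a - 2)"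
    using V2_decay by blast
  define g where "g = (\<lambda>x. V1 V x + c / (a + 1) * x powr (- a - 1))"
  have g_lim: "(g \<longlongrightarrow> 0) at_top"
  proof -
    have "((\<lambda>x. x powr (- a - 1)) \<longlongrightarrow> (0::real)) at_top"
      using a by (intro tendsto_neg_powr filterlim_ident) auto
    then have "((\<lambda>x. V1 V x + c / (a + 1) * x powr (- a - 1)) \<longlongrightarrow> 0 + c / (a + 1) * 0) at_top"
      by (intro tendsto_intros V1_tendsto_0)
    then show ?thesis unfolding g_def by simp
  qed
  have g_mono: "g y \<le> g x" if "1 \<le> x" "x \<le> y" for x y
  proof (rule DERIV_nonpos_imp_nonincreasing[OF that(2)])
    fix t assume t: "x \<le> t" "t \<le> y"
    have "(g has_real_derivative V2 V t + c / (a + 1) * ((- a - 1) * t powr (- a - 1 - 1))) (at t)"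
      unfolding g_def using t that
      by (intro DERIV_add DERIV_cmult V1_has_derivative has_real_derivative_powr) auto
    also have "c / (a + 1) * ((- a - 1) * t powr (- a - 1 - 1)) = - (c * t powr (- a - 2))"
    proof -
      have "- a - 1 - 1 = - a - 2" by simp
      moreover have "c / (a + 1) * ((- a - 1) * T) = - (c * T)" for T
        using a by (simp add: divide_simps) (simp add: algebra_simps)
      ultimately show ?thesis by metis
    qed
    finally show "\<exists>z. DERIV g t :> z \<and> z \<le> 0"
      using V2[of t] t that by (intro exI[of _ "V2 V t + - (c * t powr (- a - 2))"]) auto
  qed
  have "\<bar>V1 V x\<bar> \<le> c / (a + 1) * x powr (- a - 1)" if "x \<ge> 1" for x
  proof -
    have "0 \<le> g x"
    proof (rule tendsto_upperbound[OF g_lim])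
      show "\<forall>\<^sub>F y in at_top. g y \<le> g x"
        using eventually_ge_at_top[of x] by eventually_elim (use g_mono that in auto)
    qed simp
    then show ?thesis using V1_neg[of x] that by (simp add: g_def)
  qed
  with a c show ?thesis by (intro that[of a "c / (a + 1)"]) auto
qed

lemma potential_taylor:
  assumes "x > 0" "y > 0" "x \<noteq> y"
  obtains t where "min x y < t" "t < max x y"
    "real_of_ereal (V y) = real_of_ereal (V x) + V1 V x * (y - x) + V2 V t / 2 * (y - x)\<^sup>2"
proof -
  define D where "D = (\<lambda>m::nat. if m = 0 then (\<lambda>x. real_of_ereal (V x)) else if m = 1 then V1 V else V2 V)"
  have "\<exists>t. (if y < x then y < t \<and> t < x else x < t \<and> t < y) \<and>
      real_of_ereal (V y) = (\<Sum>m<2. D m x / fact m * (y - x) ^ m) + D 2 t / fact 2 * (y - x) ^ 2"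
  proof (rule Taylor[where a = "min x y" and b = "max x y"])
    show "\<forall>m t. m < 2 \<and> min x y \<le> t \<and> t \<le> max x y \<longrightarrow> DERIV (D m) t :> D (Suc m) t"
      using assms potential_has_derivative V1_has_derivative by (auto simp: D_def)
  qed (use assms in \<open>auto simp: D_def\<close>)
  then obtain t where "if y < x then y < t \<and> t < x else x < t \<and> t < y"
      "real_of_ereal (V y) = (\<Sum>m<2. D m x / fact m * (y - x) ^ m) + D 2 t / fact 2 * (y - x) ^ 2"
    by blast
  then show ?thesis
    by (intro that[of t]) (auto simp: D_def numeral_2_eq_2 split: if_splits)
qed

lemma potential_tangent:
  assumes "x > 0" "y > 0"
  shows "real_of_ereal (V x) + V1 V x * (y - x) \<le> real_of_ereal (V y)"
proof (cases "x = y")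
  case False
  obtain t where t: "min x y < t"
    "real_of_ereal (V y) = real_of_ereal (V x) + V1 V x * (y - x) + V2 V t / 2 * (y - x)\<^sup>2"
    using potential_taylor[OF assms False] by metis
  have "t > 0" using t(1) assms by auto
  then have "0 \<le> V2 V t / 2 * (y - x)\<^sup>2"
    using V2_pos[of t] by (intro mult_nonneg_nonneg) auto
  then show ?thesis using t(2) by linarith
qed simp

section \<open>The functions \<open>\<phi>\<^sub>k\<close>\<close>

lemma phi_real:
  assumes "k \<ge> 1" "real k + y \<noteq> 0"
  shows "\<phi> V k y = ereal (real_of_ereal (V (real k + y)) - real_of_ereal (V (real k)) - V1 V (real k) * y)"
proof -
  have "V (real k + y) = ereal (real_of_ereal (V (real k + y)))" "V (real k) = ereal (real_of_ereal (V (real k)))"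
    by (rule potential_ereal, use assms in simp)+
  then show ?thesis
    unfolding \<phi>_def by (metis ereal_minus(1))
qed

lemma phi_infinite: "k \<ge> 1 \<Longrightarrow> real k + y = 0 \<Longrightarrow> \<phi> V k y = \<infinity>"
  using potential_ereal[of "real k"] unfolding \<phi>_def by (cases "V (real k)") (auto simp: potential_at_0)

lemma phi_nonneg:
  assumes "k \<ge> 1" "y \<ge> - real k"
  shows "0 \<le> \<phi> V k y"
proof (cases "real k + y = 0")
  case False
  then show ?thesis
    using potential_tangent[of "real k" "real k + y"] assms by (simp add: phi_real)
qed (use assms in \<open>simp add: phi_infinite\<close>)

lemma phi_tendsto:
  assumes "k \<ge> 1" "(f \<longlongrightarrow> y) F"
  shows "((\<lambda>x. \<phi> V k (f x)) \<longlongrightarrow> \<phi> V k y) F"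
proof -
  obtain r where r: "V (real k) = ereal r"
    using potential_ereal[of "real k"] assms(1) by auto
  \<comment> \<open>Only \<open>V (real k + y)\<close> can be infinite; collecting the rest in one
    real number rules out any \<open>\<infinity> - \<infinity>\<close>.\<close>
  have *: "\<phi> V k y = V (real k + y) + ereal (- r - V1 V (real k) * y)" for y
    by (cases "V (real k + y)") (auto simp: \<phi>_def r)
  have "((\<lambda>x. V (real k + f x)) \<longlongrightarrow> V (real k + y)) F"
    by (rule isCont_tendsto_compose[OF isCont_potential]) (intro tendsto_intros assms(2))
  moreover have "V (real k + y) \<noteq> - \<infinity>"
    using potential_ereal[of "real k + y"] potential_at_0
    by (cases "real k + y = 0"; cases "V (real k + y)") auto
  ultimately show ?thesis
    unfolding * by (intro tendsto_add_ereal_nonneg tendsto_intros assms(2)) auto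
qed

text \<open>Strong convexity on \<open>(0, 2)\<close> gives quadratic growth up to
  \<open>y = 1\<close>. Beyond that only linear growth can be expected, because \<open>V\<close>
  tends to \<open>0\<close> and the term \<open>- V'(1) y\<close> dominates.\<close>

lemma phi_1_lower_bound:
  obtains c where "c > 0" "\<And>y. y \<ge> -1 \<Longrightarrow> ereal (c * min (y\<^sup>2) \<bar>y\<bar>) \<le> \<phi> V 1 y"
proof -
  obtain lam where lam: "lam > 0" "\<And>y. 0 < y \<Longrightarrow> y < 2 \<Longrightarrow> lam \<le> V2 V y"
    using V2_lower_bound[of 2] by auto
  have quad: "lam / 2 * y\<^sup>2 \<le> real_of_ereal (V (1 + y)) - real_of_ereal (V 1) - V1 V 1 * y"
    if "-1 < y" "y \<le> 1" for y
  proof (cases "y = 0")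
    case False
    obtain t where t: "min 1 (1 + y) < t" "t < max 1 (1 + y)"
      "real_of_ereal (V (1 + y)) = real_of_ereal (V 1) + V1 V 1 * (1 + y - 1) + V2 V t / 2 * (1 + y - 1)\<^sup>2"
      by (rule potential_taylor[of 1 "1 + y"]) (use \<open>-1 < y\<close> False in auto)
    have "lam \<le> V2 V t" using t(1,2) that by (intro lam) auto
    then have "lam / 2 * y\<^sup>2 \<le> V2 V t / 2 * y\<^sup>2" by (intro mult_right_mono) auto
    then show ?thesis using t(3) by simp
  qed simp
  \<comment> \<open>The tangent at \<open>2\<close> starts from the height \<open>lam / 2\<close>
    reached at \<open>y = 1\<close> and, relative to the tangent at \<open>1\<close>, rises with
    slope at least \<open>lam\<close>.\<close>
  have lin: "lam / 2 * y \<le> real_of_ereal (V (1 + y)) - real_of_ereal (V 1) - V1 V 1 * y"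
    if "1 \<le> y" for y
  proof -
    have 1: "real_of_ereal (V 2) + V1 V 2 * (y - 1) \<le> real_of_ereal (V (1 + y))"
      using potential_tangent[of 2 "1 + y"] that by simp
    have 2: "lam / 2 \<le> real_of_ereal (V 2) - real_of_ereal (V 1) - V1 V 1"
      using quad[of 1] by simp
    have 3: "V1 V 1 + lam \<le> V1 V 2"
    proof -
      obtain t where "1 < t" "t < 2" "V1 V 2 - V1 V 1 = (2 - 1) * V2 V t"
        using MVT2[of 1 2 "V1 V" "V2 V"] V1_has_derivative by auto
      with lam(2)[of t] show ?thesis by auto
    qed
    have "lam * (y - 1) \<le> (V1 V 2 - V1 V 1) * (y - 1)"
      using 3 that by (intro mult_right_mono) auto
    moreover have "lam \<le> lam * y"
      using lam(1) that by simp
    ultimately show ?thesis using 1 2 by (simp add: algebra_simps)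
  qed
  have "ereal (lam / 2 * min (y\<^sup>2) \<bar>y\<bar>) \<le> \<phi> V 1 y" if "y \<ge> -1" for y
  proof (cases "y = -1")
    case True
    then show ?thesis by (simp add: phi_infinite)
  next
    case False
    have "lam / 2 * min (y\<^sup>2) \<bar>y\<bar> \<le> real_of_ereal (V (1 + y)) - real_of_ereal (V 1) - V1 V 1 * y"
    proof (cases "y \<le> 1")
      case True
      have "lam / 2 * min (y\<^sup>2) \<bar>y\<bar> \<le> lam / 2 * y\<^sup>2"
        using lam(1) by (intro mult_left_mono) auto
      then show ?thesis using quad[of y] True that False by linarith
    next
      case F: False
      have "lam / 2 * min (y\<^sup>2) \<bar>y\<bar> \<le> lam / 2 * y"
        using lam(1) F by (intro mult_left_mono) auto
      then show ?thesis using lin[of y] F by linarith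
    qed
    then show ?thesis using phi_real[of 1 y] that False by simp
  qed
  with lam(1) show ?thesis by (intro that[of "lam / 2"]) auto
qed

text \<open>For \<open>y \<ge> - k / 2\<close> the intermediate Taylor point stays above
  \<open>k / 2\<close>, away from the singularity, so the decay of \<open>V''\<close> applies.
  Writing the bound in \<open>y / k\<close> leaves the weight \<open>k powr (- a)\<close>, which is
  summable.\<close>

lemma phi_upper_bound:
  obtains w where "summable w" "\<And>k. 0 \<le> w k"
    "\<And>k y. k \<ge> 1 \<Longrightarrow> y \<ge> - real k / 2 \<Longrightarrow> \<phi> V k y \<le> ereal (w k * (y / real k)\<^sup>2)"
proof -
  obtain a c where a: "a > 3/2" and c: "c > 0"
    and V2: "\<And>x. x \<ge> 1/2 \<Longrightarrow> V2 V x \<le> c * x powr (- a - 2)"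
    using V2_decay by blast
  \<comment> \<open>\<open>1 / 2\<close> is the Taylor factor; the power of \<open>1/2\<close> pays
    for evaluating the decay at \<open>k / 2\<close> instead of \<open>k\<close>.\<close>
  define C where "C = c / 2 * (1/2) powr (- a - 2)"
  have C: "C \<ge> 0" using c by (simp add: C_def)
  show ?thesis
  proof (rule that[of "\<lambda>k. C * real k powr (- a)"])
    show "summable (\<lambda>k. C * real k powr (- a))"
      using a by (intro summable_mult) (simp add: summable_real_powr_iff)
    show "0 \<le> C * real k powr (- a)" for k using C by simp
    fix k :: nat and y :: real
    assume k: "k \<ge> 1" and y: "y \<ge> - real k / 2"
    have pos: "real k > 0" "real k + y > 0" using k y by auto
    have "real_of_ereal (V (real k + y)) - real_of_ereal (V (real k)) - V1 V (real k) * y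
        \<le> C * real k powr (- a) * (y / real k)\<^sup>2"
    proof (cases "y = 0")
      case False
      obtain t where t: "min (real k) (real k + y) < t"
        "real_of_ereal (V (real k + y)) = real_of_ereal (V (real k)) + V1 V (real k) * (real k + y - real k)
           + V2 V t / 2 * (real k + y - real k)\<^sup>2"
        by (rule potential_taylor[of "real k" "real k + y"]) (use pos False in auto)
      have t2: "t \<ge> 1/2 * real k" using t(1) y k by (auto simp: min_def split: if_splits)
      have "V2 V t \<le> c * t powr (- a - 2)" using t2 k by (intro V2) auto
      also have "\<dots> \<le> c * (1/2 * real k) powr (- a - 2)"
        using a c t2 pos by (intro mult_left_mono powr_mono2') auto
      also have "\<dots> = 2 * C * real k powr (- a - 2)"
        unfolding C_def by (subst powr_mult) auto
      also have "\<dots> = 2 * C * (real k powr (- a) / (real k)\<^sup>2)"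
        using pos by (simp add: powr_diff powr_numeral)
      finally have "V2 V t \<le> 2 * (C * (real k powr (- a) / (real k)\<^sup>2))"
        by (simp only: mult.assoc)
      then have "V2 V t / 2 \<le> C * (real k powr (- a) / (real k)\<^sup>2)" by linarith
      then have "V2 V t / 2 * y\<^sup>2 \<le> C * (real k powr (- a) / (real k)\<^sup>2) * y\<^sup>2"
        by (rule mult_right_mono) simp
      moreover have "C * real k powr (- a) * (y / real k)\<^sup>2 = C * (real k powr (- a) / (real k)\<^sup>2) * y\<^sup>2"
        by (simp add: power_divide)
      ultimately show ?thesis using t(2) by simp
    qed simp
    then show "\<phi> V k y \<le> ereal (C * real k powr (- a) * (y / real k)\<^sup>2)"
      using phi_real[of k y] k pos by simp
  qed
qed

section \<open>The boundary force \<open>\<sigma>\<^sup>\<infinity>\<close>\<close>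

text \<open>The majorant behind both the series for \<open>\<sigma>_inf\<close> and the passage to
  the limit in \<open>sigma_n_tendsto\<close>.\<close>

lemma summable_V1_moment: "summable (\<lambda>k. \<bar>V1 V (real k)\<bar> * real k)"
proof -
  obtain a C where a: "a > 3/2" and C: "C > 0"
    and V1: "\<And>x. x \<ge> 1 \<Longrightarrow> \<bar>V1 V x\<bar> \<le> C * x powr (- a - 1)"
    using V1_decay by blast
  show ?thesis
  proof (rule summable_comparison_test')
    show "summable (\<lambda>k. C * real k powr (- a))"
      using a by (intro summable_mult) (simp add: summable_real_powr_iff)
    fix k :: nat assume k: "k \<ge> 1"
    have "\<bar>V1 V (real k)\<bar> * real k \<le> C * real k powr (- a - 1) * real k"
      using k V1[of k] by (intro mult_right_mono) auto
    also have "\<dots> = C * real k powr (- a)"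
      using k by (simp add: powr_diff)
    finally show "norm (\<bar>V1 V (real k)\<bar> * real k) \<le> C * real k powr (- a)" by simp
  qed
qed

lemma summable_sigma_inf_terms: "summable (\<lambda>k. \<bar>V1 V (real k)\<bar> * real (k - i))"
  by (rule summable_comparison_test'[OF summable_V1_moment]) (auto intro!: mult_left_mono)

text \<open>Truncated subtraction removes the terms with \<open>k \<le> i\<close>, so the series
  runs over all \<open>k\<close> and can be compared with \<open>sigma_n\<close> term by
  term.\<close>

lemma sigma_inf_eq: "i \<ge> 1 \<Longrightarrow> \<sigma>_inf V i = (\<Sum>k. \<bar>V1 V (real k)\<bar> * real (k - i))"
  unfolding \<sigma>_inf_def using suminf_split_initial_segment[OF summable_sigma_inf_terms[of i], of "i + 1"]
  by (simp add: algebra_simps)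

lemma sigma_inf_nonneg: "0 \<le> \<sigma>_inf V i"
  by (cases "i = 0")
     (simp_all add: \<sigma>_inf_def[of V 0] sigma_inf_eq suminf_nonneg summable_sigma_inf_terms)

lemma sigma_inf_ell2: "\<sigma>_inf V \<in> ell2"
proof -
  obtain a C where a: "a > 3/2" and C: "C > 0"
    and V1: "\<And>x. x \<ge> 1 \<Longrightarrow> \<bar>V1 V x\<bar> \<le> C * x powr (- a - 1)"
    using V1_decay by blast
  \<comment> \<open>The excess of \<open>a\<close> over \<open>3/2 = 1/2 + 1\<close> is shared
    equally: \<open>q > 1\<close> serves the sum over \<open>m\<close>, \<open>p > 1/2\<close> the
    sum of squares over \<open>i\<close>.\<close>
  define p q where "p = 1/2 + (a - 3/2) / 2" and "q = 1 + (a - 3/2) / 2"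
  have p: "p > 1/2" and q: "q > 1" and pq: "a = p + q" using a by (auto simp: p_def q_def)
  have sum_q: "summable (\<lambda>m. real (m + 1) powr (- q))"
    using q summable_Suc_iff[of "\<lambda>m. real m powr (- q)"] by (simp add: summable_real_powr_iff add.commute)
  define S where "S = (\<Sum>m. real (m + 1) powr (- q))"
  have bound: "\<sigma>_inf V i \<le> C * S * real i powr (- p)" if i: "i \<ge> 1" for i
  proof -
    have term_bound: "real (m + 1) * \<bar>V1 V (real (i + 1 + m))\<bar>
        \<le> C * real i powr (- p) * real (m + 1) powr (- q)" for m
    proof -
      let ?x = "real (i + 1 + m)"
      \<comment> \<open>The factor \<open>m + 1\<close> is raised to the argument
        \<open>i + 1 + m\<close>, which costs one power of decay; the remaining power
        \<open>- a\<close> splits, since the argument is at least \<open>i\<close> and at least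
        \<open>m + 1\<close>.\<close>
      have "real (m + 1) * \<bar>V1 V ?x\<bar> \<le> ?x * (C * ?x powr (- a - 1))"
        using V1[of ?x] by (intro mult_mono) auto
      also have "\<dots> = C * (?x powr (- p) * ?x powr (- q))"
      proof -
        have "?x powr (- p) * ?x powr (- q) = ?x powr (- a)"
          by (simp add: powr_add[symmetric] pq)
        moreover have "?x * ?x powr (- a - 1) = ?x powr (- a)"
          by (simp add: powr_diff del: of_nat_add)
        ultimately show ?thesis by (simp add: algebra_simps)
      qed
      also have "\<dots> \<le> C * (real i powr (- p) * real (m + 1) powr (- q))"
        using i C p q by (intro mult_left_mono mult_mono powr_mono2') auto
      finally show ?thesis by (simp add: algebra_simps)
    qed
    have "\<sigma>_inf V i = (\<Sum>m. real (m + 1) * \<bar>V1 V (real (i + 1 + m))\<bar>)"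
      using i by (simp add: \<sigma>_inf_def)
    also have "\<dots> \<le> (\<Sum>m. C * real i powr (- p) * real (m + 1) powr (- q))"
    proof (rule suminf_le[OF term_bound])
      show "summable (\<lambda>m. C * real i powr (- p) * real (m + 1) powr (- q))"
        by (intro summable_mult sum_q)
      then show "summable (\<lambda>m. real (m + 1) * \<bar>V1 V (real (i + 1 + m))\<bar>)"
        by (rule summable_comparison_test'[where N = 0]) (use term_bound in auto)
    qed
    also have "\<dots> = C * S * real i powr (- p)"
      unfolding S_def by (subst suminf_mult[OF sum_q]) (simp add: algebra_simps)
    finally show ?thesis .
  qed
  have "summable (\<lambda>i. (\<sigma>_inf V i)\<^sup>2)"
  proof (rule summable_comparison_test')
    show "summable (\<lambda>i. (C * S)\<^sup>2 * real i powr (- 2 * p))"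
      using p by (intro summable_mult) (simp add: summable_real_powr_iff)
    fix i :: nat assume i: "i \<ge> 1"
    have "(\<sigma>_inf V i)\<^sup>2 \<le> (C * S * real i powr (- p))\<^sup>2"
      using bound[OF i] sigma_inf_nonneg by (intro power_mono) auto
    also have "\<dots> = (C * S)\<^sup>2 * (real i powr (- p))\<^sup>2"
      by (simp add: power_mult_distrib)
    also have "(real i powr (- p))\<^sup>2 = real i powr (- 2 * p)"
      by (simp add: power2_eq_square powr_add[symmetric])
    finally show "norm ((\<sigma>_inf V i)\<^sup>2) \<le> (C * S)\<^sup>2 * real i powr (- 2 * p)" by simp
  qed
  then show ?thesis by (simp add: ell2_def \<sigma>_inf_def)
qed

end

section \<open>Square-summable sequences\<close>

lemma ell2_summable_mult:
  assumes "x \<in> ell2" "y \<in> ell2"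
  shows "summable (\<lambda>i. x i * y i)"
proof (rule summable_comparison_test')
  show "summable (\<lambda>i. (x i)\<^sup>2 + (y i)\<^sup>2)"
    using assms by (intro summable_add) (auto simp: ell2_def)
  show "norm (x i * y i) \<le> (x i)\<^sup>2 + (y i)\<^sup>2" for i
  proof -
    have "0 \<le> \<bar>x i\<bar> * \<bar>y i\<bar>" by simp
    moreover have "2 * (\<bar>x i\<bar> * \<bar>y i\<bar>) \<le> (x i)\<^sup>2 + (y i)\<^sup>2"
      using sum_squares_bound[of "\<bar>x i\<bar>" "\<bar>y i\<bar>"] by (simp add: mult.assoc)
    ultimately have "\<bar>x i\<bar> * \<bar>y i\<bar> \<le> (x i)\<^sup>2 + (y i)\<^sup>2" by linarith
    then show ?thesis by (simp add: abs_mult)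
  qed
qed

lemma ell2_finite_support:
  assumes "x 0 = 0" "\<And>i. i > n \<Longrightarrow> x i = 0"
  shows "x \<in> ell2"
proof -
  have "summable (\<lambda>i. (x i)\<^sup>2)"
    by (rule summable_finite[of "{..n}"]) (use assms(2) in \<open>auto simp: not_le\<close>)
  with assms(1) show ?thesis by (simp add: ell2_def)
qed

lemma ell2_inner_finite_support:
  assumes "\<And>i. i > n \<Longrightarrow> x i = 0" "x 0 = 0 \<or> y 0 = 0"
  shows "ell2_inner x y = (\<Sum>i=1..n. x i * y i)"
proof -
  have "ell2_inner x y = (\<Sum>i\<in>{..n}. x i * y i)"
    unfolding ell2_inner_def by (rule suminf_finite) (use assms in \<open>auto simp: not_le\<close>)
  also have "\<dots> = (\<Sum>i=1..n. x i * y i)"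
    using assms(2) by (intro sum.mono_neutral_right) (auto simp: not_less_eq_eq Suc_le_eq)
  finally show ?thesis .
qed

lemma ell2_inner_commute: "ell2_inner x y = ell2_inner y x"
  by (simp add: ell2_inner_def mult.commute)

lemma ell2_inner_self_nonneg: "x \<in> ell2 \<Longrightarrow> 0 \<le> ell2_inner x x"
  unfolding ell2_inner_def using ell2_summable_mult by (intro suminf_nonneg) auto

lemma sum_le_ell2_inner:
  assumes "x \<in> ell2" "finite A"
  shows "(\<Sum>i\<in>A. (x i)\<^sup>2) \<le> ell2_inner x x"
  unfolding ell2_inner_def using assms ell2_summable_mult[of x x]
  by (auto simp: power2_eq_square intro!: sum_le_suminf)

lemma left_half_eq: "left_half n x i = (if 1 \<le> i \<and> i \<le> (n + 1) div 2 then x i else 0)"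
proof -
  have "nat \<lceil>real n / 2\<rceil> = (n + 1) div 2" by linarith
  then show ?thesis by (simp add: left_half_def)
qed

lemma right_half_eq: "right_half n x = left_half n (\<lambda>i. x (n + 1 - i))"
  by (simp add: right_half_def left_half_def fun_eq_iff)

lemma left_half_ell2: "left_half n x \<in> ell2"
  by (rule ell2_finite_support[of _ "(n + 1) div 2"]) (auto simp: left_half_eq)

lemma weak_conv_pointwise:
  assumes "weak_conv X x" "i \<ge> 1"
  shows "(\<lambda>n. X n i) \<longlonglongrightarrow> x i"
proof -
  define e where "e = (\<lambda>j. if j = i then 1 else (0::real))"
  have inner: "ell2_inner y e = y i" for y
  proof -
    have "ell2_inner y e = (\<Sum>j\<in>{i}. y j * e j)"
      unfolding ell2_inner_def by (rule suminf_finite) (auto simp: e_def)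
    then show ?thesis by (simp add: e_def)
  qed
  have "e \<in> ell2" using assms(2) by (intro ell2_finite_support[of _ i]) (auto simp: e_def)
  then have "(\<lambda>n. ell2_inner (X n) e) \<longlonglongrightarrow> ell2_inner x e"
    using assms(1) unfolding weak_conv_def by blast
  then show ?thesis by (simp only: inner)
qed

lemma ell2_Cauchy_Schwarz:
  assumes "x \<in> ell2" "y \<in> ell2"
  shows "\<bar>ell2_inner x y\<bar> \<le> sqrt (ell2_inner x x) * sqrt (ell2_inner y y)"
proof -
  have lim: "(\<lambda>n. \<Sum>i<n. u i * v i) \<longlonglongrightarrow> ell2_inner u v" if "u \<in> ell2" "v \<in> ell2" for u v
    unfolding ell2_inner_def using summable_LIMSEQ[OF ell2_summable_mult[OF that]] .
  have "\<bar>ell2_inner x y\<bar>\<^sup>2 \<le> ell2_inner x x * ell2_inner y y"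
  proof (rule LIMSEQ_le)
    show "(\<lambda>n. \<bar>\<Sum>i<n. x i * y i\<bar>\<^sup>2) \<longlonglongrightarrow> \<bar>ell2_inner x y\<bar>\<^sup>2"
      by (intro tendsto_intros lim assms)
    show "(\<lambda>n. (\<Sum>i<n. x i * x i) * (\<Sum>i<n. y i * y i)) \<longlonglongrightarrow> ell2_inner x x * ell2_inner y y"
      by (intro tendsto_intros lim assms)
    show "\<exists>N. \<forall>n\<ge>N. \<bar>\<Sum>i<n. x i * y i\<bar>\<^sup>2 \<le> (\<Sum>i<n. x i * x i) * (\<Sum>i<n. y i * y i)"
      using Cauchy_Schwarz_ineq_sum[of x y] by (simp add: power2_eq_square)
  qed
  then show ?thesis
    by (simp add: real_sqrt_mult[symmetric] real_le_rsqrt)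
qed

text \<open>Dominated convergence, used to upgrade pointwise convergence of the boundary forces to
  convergence in norm.\<close>

lemma tannery_sum_squares_tendsto_0:
  fixes s :: "nat \<Rightarrow> nat \<Rightarrow> real"
  assumes lim: "\<And>i. (\<lambda>n. s n i) \<longlonglongrightarrow> 0"
    and bound: "\<And>n i. \<bar>s n i\<bar> \<le> S i" and S: "S \<in> ell2"
  shows "(\<lambda>n. ell2_inner (s n) (s n)) \<longlonglongrightarrow> 0"
proof -
  have "(\<lambda>n. \<Sum>i. s n i * s n i) \<longlonglongrightarrow> (\<Sum>i::nat. 0)"
  proof (rule tannerys_theorem[THEN conjunct2, THEN conjunct2])
    show "(\<lambda>n. s n i * s n i) \<longlonglongrightarrow> 0" for i
      using tendsto_mult[OF lim lim, of i i] by simp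
    show "\<forall>\<^sub>F (i, n) in sequentially \<times>\<^sub>F sequentially. norm (s n i * s n i) \<le> S i * S i"
    proof (intro always_eventually allI, clarify)
      fix i n
      have "\<bar>s n i\<bar> * \<bar>s n i\<bar> \<le> S i * S i"
        by (intro mult_mono bound order_trans[OF abs_ge_zero bound] abs_ge_zero)
      then show "norm (s n i * s n i) \<le> S i * S i" by (simp add: abs_mult)
    qed
    show "summable (\<lambda>i. S i * S i)" by (rule ell2_summable_mult[OF S S])
  qed simp
  then show ?thesis by (simp add: ell2_inner_def)
qed

section \<open>Double series of extended reals\<close>

lemma incseq_square_sums:
  fixes f :: "nat \<Rightarrow> nat \<Rightarrow> ereal"
  assumes "\<And>k j. 0 \<le> f k j"
  shows "incseq (\<lambda>K. \<Sum>k<K. \<Sum>j<K. f k j)"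
proof (rule incseq_SucI)
  fix K
  have "(\<Sum>k<K. \<Sum>j<K. f k j) \<le> (\<Sum>k<K. \<Sum>j<Suc K. f k j)"
    using assms by (intro sum_mono sum_mono2) auto
  also have "\<dots> \<le> (\<Sum>k<Suc K. \<Sum>j<Suc K. f k j)"
    using assms by (intro sum_mono2 sum_nonneg) auto
  finally show "(\<Sum>k<K. \<Sum>j<K. f k j) \<le> (\<Sum>k<Suc K. \<Sum>j<Suc K. f k j)" .
qed

text \<open>Square truncations allow a single cutoff for both indices and, in the next lemma, for
  both boundary layers.\<close>

lemma suminf_suminf_ereal_eq_SUP:
  fixes f :: "nat \<Rightarrow> nat \<Rightarrow> ereal"
  assumes nonneg: "\<And>k j. 0 \<le> f k j"
  shows "(\<Sum>k. \<Sum>j. f k j) = (SUP K. \<Sum>k<K. \<Sum>j<K. f k j)"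
proof (rule antisym)
  have inner: "0 \<le> (\<Sum>j. f k j)" for k by (rule suminf_0_le) (rule nonneg)
  have "(\<Sum>k<N. \<Sum>j. f k j) \<le> (SUP K. \<Sum>k<K. \<Sum>j<K. f k j)" for N
  proof -
    have "(\<Sum>k<N. \<Sum>j. f k j) = (\<Sum>j. \<Sum>k<N. f k j)"
      by (rule suminf_sum_ereal[symmetric]) (rule nonneg)
    also have "\<dots> \<le> (SUP K. \<Sum>k<K. \<Sum>j<K. f k j)"
    proof (rule suminf_bound)
      show "\<forall>M. (\<Sum>j<M. \<Sum>k<N. f k j) \<le> (SUP K. \<Sum>k<K. \<Sum>j<K. f k j)"
      proof
        fix M
        have "(\<Sum>j<M. \<Sum>k<N. f k j) = (\<Sum>k<N. \<Sum>j<M. f k j)" by (rule sum.swap)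
        also have "\<dots> \<le> (\<Sum>k<max N M. \<Sum>j<max N M. f k j)"
          using nonneg by (intro order_trans[OF sum_mono sum_mono2] sum_mono2 sum_nonneg) auto
        also have "\<dots> \<le> (SUP K. \<Sum>k<K. \<Sum>j<K. f k j)" by (rule SUP_upper) simp
        finally show "(\<Sum>j<M. \<Sum>k<N. f k j) \<le> (SUP K. \<Sum>k<K. \<Sum>j<K. f k j)" .
      qed
    qed (intro sum_nonneg nonneg)
    finally show ?thesis .
  qed
  then show "(\<Sum>k. \<Sum>j. f k j) \<le> (SUP K. \<Sum>k<K. \<Sum>j<K. f k j)"
    by (intro suminf_bound inner) auto
  have "(\<Sum>k<K. \<Sum>j<K. f k j) \<le> (\<Sum>k. \<Sum>j. f k j)" for K
  proof -
    have "(\<Sum>k<K. \<Sum>j<K. f k j) \<le> (\<Sum>k<K. \<Sum>j. f k j)"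
      by (intro sum_mono suminf_upper nonneg)
    also have "\<dots> \<le> (\<Sum>k. \<Sum>j. f k j)" by (intro suminf_upper inner)
    finally show ?thesis .
  qed
  then show "(SUP K. \<Sum>k<K. \<Sum>j<K. f k j) \<le> (\<Sum>k. \<Sum>j. f k j)"
    by (intro SUP_least)
qed

text \<open>A strict lower bound on the total is already witnessed by finitely many terms. This
  treats finite and infinite limit energies alike.\<close>

lemma less_double_series_add:
  fixes f g :: "nat \<Rightarrow> nat \<Rightarrow> ereal"
  assumes nonneg: "\<And>k j. 0 \<le> f k j" "\<And>k j. 0 \<le> g k j"
    and less: "c < (\<Sum>k. \<Sum>j. f k j) + (\<Sum>k. \<Sum>j. g k j) + ereal r"
  obtains K where "c < (\<Sum>k<K. \<Sum>j<K. f k j) + (\<Sum>k<K. \<Sum>j<K. g k j) + ereal r"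
proof -
  let ?F = "\<lambda>K. \<Sum>k<K. \<Sum>j<K. f k j" and ?G = "\<lambda>K. \<Sum>k<K. \<Sum>j<K. g k j"
  have "(SUP K. ?F K + ?G K) = (SUP K. ?F K) + (SUP K. ?G K)"
    using nonneg by (intro SUP_ereal_add_pos incseq_square_sums sum_nonneg) auto
  then have "c < (SUP K. ?F K + ?G K) + ereal r"
    using less suminf_suminf_ereal_eq_SUP[of f] suminf_suminf_ereal_eq_SUP[of g] nonneg by simp
  also have "(SUP K. ?F K + ?G K) + ereal r = (SUP K. ?F K + ?G K + ereal r)"
    by (rule SUP_ereal_add_left[symmetric]) auto
  finally show ?thesis using that by (auto simp: less_SUP_iff)
qed

section \<open>Decomposition of the finite energies\<close>

text \<open>The number of windows \<open>{j+1..j+k}\<close> inside \<open>{1..n}\<close> that contain \<open>l\<close> is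
  \<open>min (min k (n+1-k)) (min l (n+1-l))\<close>. As \<open>\<epsilon>\<close> has mean zero, its value \<open>min k (n+1-k)\<close> in the bulk
  may be subtracted. What remains is the coefficient below; its natural-number subtraction is
  truncated on purpose.\<close>

definition sigma_n :: "(real \<Rightarrow> ereal) \<Rightarrow> nat \<Rightarrow> nat \<Rightarrow> real" where
  "sigma_n V n l = (\<Sum>k=1..n. \<bar>V1 V (real k)\<bar> * real (min k (n + 1 - k) - min l (n + 1 - l)))"

lemma card_windows_containing:
  assumes "1 \<le> k" "k \<le> n" "1 \<le> l" "l \<le> n"
  shows "card {j \<in> {0..n-k}. j + 1 \<le> l \<and> l \<le> j + k} = min (min k (n + 1 - k)) (min l (n + 1 - l))"
proof -
  \<comment> \<open>For \<open>l \<le> k\<close> truncated subtraction turns the lower end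
    \<open>l - k\<close> into \<open>0\<close>, which is the correct bound.\<close>
  have "{j \<in> {0..n-k}. j + 1 \<le> l \<and> l \<le> j + k} = {l - k .. min (l - 1) (n - k)}"
    using assms by auto
  then have "card {j \<in> {0..n-k}. j + 1 \<le> l \<and> l \<le> j + k} = Suc (min (l - 1) (n - k)) - (l - k)"
    by simp
  also have "\<dots> = min (min k (n + 1 - k)) (min l (n + 1 - l))"
  proof -
    consider "l \<le> k" "l - 1 \<le> n - k" | "l \<le> k" "l - 1 > n - k"
      | "l > k" "l - 1 \<le> n - k" | "l > k" "l - 1 > n - k" by linarith
    then show ?thesis
    proof cases
      case 1
      then have "l \<le> n + 1 - k" "l \<le> n + 1 - l" using assms by auto
      then show ?thesis using 1 assms by simp
    next
      case 2
      then have "n + 1 - k \<le> k" "n + 1 - k \<le> l" "n + 1 - k \<le> n + 1 - l" using assms by auto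
      then show ?thesis using 2 assms by simp
    next
      case 3
      then have "k \<le> n + 1 - k" "k \<le> l" "k \<le> n + 1 - l" using assms by auto
      then show ?thesis using 3 assms by simp
    next
      case 4
      then have "n + 1 - l \<le> k" "n + 1 - l \<le> l" "n + 1 - l \<le> n + 1 - k" using assms by auto
      then show ?thesis using 4 assms by simp
    qed
  qed
  finally show ?thesis .
qed

lemma sum_windows:
  fixes x :: "nat \<Rightarrow> real"
  assumes "1 \<le> k" "k \<le> n"
  shows "(\<Sum>j=0..n-k. \<Sum>l=j+1..j+k. x l)
    = (\<Sum>l=1..n. real (min (min k (n + 1 - k)) (min l (n + 1 - l))) * x l)"
proof -
  have "(\<Sum>j=0..n-k. \<Sum>l=j+1..j+k. x l)
      = (\<Sum>j=0..n-k. \<Sum>l=1..n. if j + 1 \<le> l \<and> l \<le> j + k then x l else 0)"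
  proof (rule sum.cong[OF refl])
    fix j assume "j \<in> {0..n-k}"
    then show "(\<Sum>l=j+1..j+k. x l) = (\<Sum>l=1..n. if j + 1 \<le> l \<and> l \<le> j + k then x l else 0)"
      using assms by (subst sum.inter_filter[symmetric]) (auto intro!: sum.cong)
  qed
  also have "\<dots> = (\<Sum>l=1..n. \<Sum>j=0..n-k. if j + 1 \<le> l \<and> l \<le> j + k then x l else 0)"
    by (rule sum.swap)
  also have "\<dots> = (\<Sum>l=1..n. real (min (min k (n + 1 - k)) (min l (n + 1 - l))) * x l)"
  proof (rule sum.cong[OF refl])
    fix l assume "l \<in> {1..n}"
    then show "(\<Sum>j=0..n-k. if j + 1 \<le> l \<and> l \<le> j + k then x l else 0)
        = real (min (min k (n + 1 - k)) (min l (n + 1 - l))) * x l"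
      using card_windows_containing[OF assms, of l] by (subst sum.inter_filter[symmetric]) simp_all
  qed
  finally show ?thesis .
qed

lemma real_min_diff: "real (min a b) - real a = - real (a - b)"
  by linarith

lemma linear_part_eq:
  fixes x :: "nat \<Rightarrow> real"
  assumes mean0: "(\<Sum>l=1..n. x l) = 0" and neg: "\<And>k. k \<ge> 1 \<Longrightarrow> V1 V (real k) < 0"
  shows "(\<Sum>k=1..n. \<Sum>j=0..n-k. V1 V (real k) * (\<Sum>l=j+1..j+k. x l)) = (\<Sum>l=1..n. sigma_n V n l * x l)"
proof -
  have "(\<Sum>k=1..n. \<Sum>j=0..n-k. V1 V (real k) * (\<Sum>l=j+1..j+k. x l))
      = (\<Sum>k=1..n. \<Sum>l=1..n. \<bar>V1 V (real k)\<bar> * real (min k (n + 1 - k) - min l (n + 1 - l)) * x l)"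
  proof (rule sum.cong[OF refl])
    fix k assume k: "k \<in> {1..n}"
    let ?d = "\<lambda>l. real (min (min k (n + 1 - k)) (min l (n + 1 - l)))"
    \<comment> \<open>Mean zero allows a multiple of the full sum to be inserted. The difference of
      coefficients is then nonpositive, and its sign cancels against \<open>V' < 0\<close>.\<close>
    have "(\<Sum>j=0..n-k. V1 V (real k) * (\<Sum>l=j+1..j+k. x l))
        = V1 V (real k) * ((\<Sum>l=1..n. ?d l * x l) - real (min k (n + 1 - k)) * (\<Sum>l=1..n. x l))"
      unfolding sum_distrib_left[symmetric] mean0 using k by (subst sum_windows) auto
    also have "\<dots> = V1 V (real k) * (\<Sum>l=1..n. (?d l - real (min k (n + 1 - k))) * x l)"
      by (simp add: sum_distrib_left sum_subtractf left_diff_distrib)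
    also have "\<dots> = (\<Sum>l=1..n. \<bar>V1 V (real k)\<bar> * real (min k (n + 1 - k) - min l (n + 1 - l)) * x l)"
      unfolding sum_distrib_left
    proof (rule sum.cong[OF refl])
      fix l
      have "?d l - real (min k (n + 1 - k)) = - real (min k (n + 1 - k) - min l (n + 1 - l))"
        by (rule real_min_diff)
      then show "V1 V (real k) * ((?d l - real (min k (n + 1 - k))) * x l)
          = \<bar>V1 V (real k)\<bar> * real (min k (n + 1 - k) - min l (n + 1 - l)) * x l"
        using neg[of k] k by simp
    qed
    finally show "(\<Sum>j=0..n-k. V1 V (real k) * (\<Sum>l=j+1..j+k. x l)) = \<dots>" .
  qed
  also have "\<dots> = (\<Sum>l=1..n. sigma_n V n l * x l)"
    by (subst sum.swap) (simp add: sigma_n_def sum_distrib_right)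
  finally show ?thesis .
qed

lemma sigma_n_nonneg: "0 \<le> sigma_n V n l"
  unfolding sigma_n_def by (intro sum_nonneg) auto

lemma sigma_n_reflect: "1 \<le> l \<Longrightarrow> l \<le> n \<Longrightarrow> sigma_n V n (n + 1 - l) = sigma_n V n l"
  unfolding sigma_n_def by (simp add: min.commute)

text \<open>Both halves have length \<open>(n + 1) div 2\<close>, so for odd \<open>n\<close> they
  share the central site; vanishing there makes the double count harmless.\<close>

lemma sum_eq_sum_halves:
  fixes f :: "nat \<Rightarrow> real"
  assumes "n + 1 = 2 * ((n + 1) div 2) \<Longrightarrow> f ((n + 1) div 2) = 0"
  shows "(\<Sum>l=1..n. f l) = (\<Sum>l=1..(n+1) div 2. f l) + (\<Sum>l=1..(n+1) div 2. f (n + 1 - l))"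
proof -
  let ?h = "(n + 1) div 2"
  have "(\<Sum>l=1..n. f l) = (\<Sum>l=1..?h. f l) + (\<Sum>l=?h+1..n. f l)"
    by (subst sum.union_disjoint[symmetric]) (auto intro!: sum.cong)
  also have "(\<Sum>l=?h+1..n. f l) = (\<Sum>l=1..n-?h. f (n + 1 - l))"
    by (rule sum.reindex_bij_witness[of _ "\<lambda>l. n + 1 - l" "\<lambda>l. n + 1 - l"]) auto
  also have "\<dots> = (\<Sum>l=1..?h. f (n + 1 - l))"
  proof (cases "even n")
    case True
    then have "n - ?h = ?h" by auto
    then show ?thesis by simp
  next
    case False
    then have h: "n + 1 = 2 * ?h" "n + 1 - ?h = ?h" by (auto elim!: oddE)
    then have "{1..?h} = insert ?h {1..n-?h}" by auto
    moreover have "?h \<notin> {1..n-?h}" using h by auto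
    ultimately have "(\<Sum>l=1..?h. f (n + 1 - l)) = f (n + 1 - ?h) + (\<Sum>l=1..n-?h. f (n + 1 - l))"
      by (metis finite_atLeastAtMost sum.insert)
    then show ?thesis using assms[OF h(1)] h(2) by simp
  qed
  finally show ?thesis .
qed

lemma sum_sigma_n_eq_halves:
  "(\<Sum>l=1..n. sigma_n V n l * x l)
    = (\<Sum>i=1..(n+1) div 2. sigma_n V n i * left_half n x i)
    + (\<Sum>i=1..(n+1) div 2. sigma_n V n i * right_half n x i)"
proof -
  \<comment> \<open>At the centre \<open>min l (n + 1 - l)\<close> takes its maximal value, which no
    \<open>min k (n + 1 - k)\<close> exceeds, so every truncated difference is
    \<open>0\<close>.\<close>
  have "sigma_n V n ((n + 1) div 2) = 0" if "n + 1 = 2 * ((n + 1) div 2)"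
    unfolding sigma_n_def
  proof (intro sum.neutral ballI)
    fix k
    define h where "h = (n + 1) div 2"
    have h: "n + 1 = 2 * h" using that by (simp only: h_def)
    have "min k (n + 1 - k) \<le> h" unfolding h by (cases "k \<le> h") auto
    moreover have "min h (n + 1 - h) = h" unfolding h by simp
    ultimately show "\<bar>V1 V (real k)\<bar> * real (min k (n + 1 - k) - min ((n + 1) div 2) (n + 1 - (n + 1) div 2)) = 0"
      unfolding h_def[symmetric] by simp
  qed
  then have "(\<Sum>l=1..n. sigma_n V n l * x l) = (\<Sum>l=1..(n+1) div 2. sigma_n V n l * x l)
      + (\<Sum>l=1..(n+1) div 2. sigma_n V n (n + 1 - l) * x (n + 1 - l))"
    by (intro sum_eq_sum_halves) auto
  also have "(\<Sum>l=1..(n+1) div 2. sigma_n V n l * x l) = (\<Sum>i=1..(n+1) div 2. sigma_n V n i * left_half n x i)"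
    by (rule sum.cong) (auto simp: left_half_eq)
  also have "(\<Sum>l=1..(n+1) div 2. sigma_n V n (n + 1 - l) * x (n + 1 - l))
      = (\<Sum>i=1..(n+1) div 2. sigma_n V n i * right_half n x i)"
  proof (rule sum.cong[OF refl])
    fix l assume "l \<in> {1..(n+1) div 2}"
    moreover from this have "1 \<le> l" "l \<le> n" by auto
    ultimately show "sigma_n V n (n + 1 - l) * x (n + 1 - l) = sigma_n V n l * right_half n x l"
      using sigma_n_reflect[of l n V] by (simp add: right_half_eq left_half_eq)
  qed
  finally show ?thesis .
qed

section \<open>Windows, admissible configurations and sums of extended reals\<close>

lemma window_ge:
  fixes x :: "nat \<Rightarrow> real"
  assumes "\<And>l. j + 1 \<le> l \<Longrightarrow> l \<le> j + k \<Longrightarrow> - 1 \<le> x l"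
  shows "- real k \<le> (\<Sum>l=j+1..j+k. x l)"
proof -
  have "(\<Sum>l=j+1..j+k. - 1 :: real) \<le> (\<Sum>l=j+1..j+k. x l)"
    by (rule sum_mono) (use assms in auto)
  then show ?thesis by simp
qed

lemma window_reflect:
  fixes x :: "nat \<Rightarrow> real"
  assumes "j + k \<le> n"
  shows "(\<Sum>l=j+1..j+k. x (n + 1 - l)) = (\<Sum>l=n-k-j+1..n-k-j+k. x l)"
  by (rule sum.reindex_bij_witness[of _ "\<lambda>l. n + 1 - l" "\<lambda>l. n + 1 - l"]) (use assms in auto)

lemma Dom_E_ge: "x \<in> Dom_E n \<Longrightarrow> 1 \<le> l \<Longrightarrow> - 1 \<le> x l"
  unfolding Dom_E_def by (cases "l \<le> n") auto

lemma Dom_E_inner_self: "x \<in> Dom_E n \<Longrightarrow> ell2_inner x x = (\<Sum>l=1..n. (x l)\<^sup>2)"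
  by (subst ell2_inner_finite_support[of n]) (auto simp: Dom_E_def ell2_def power2_eq_square)

text \<open>Nonnegative limits keep all partial sums away from \<open>- \<infinity>\<close>, so
  addition is continuous there even if some limits are \<open>\<infinity>\<close>.\<close>

lemma tendsto_sum_ereal_nonneg:
  fixes f :: "'i \<Rightarrow> 'a \<Rightarrow> ereal"
  assumes "\<And>i. i \<in> I \<Longrightarrow> (f i \<longlongrightarrow> g i) F" "\<And>i. i \<in> I \<Longrightarrow> 0 \<le> g i"
  shows "((\<lambda>x. \<Sum>i\<in>I. f i x) \<longlongrightarrow> (\<Sum>i\<in>I. g i)) F"
  using assms
proof (induction I rule: infinite_finite_induct)
  case (insert i I)
  have "0 \<le> (\<Sum>i\<in>I. g i)" "0 \<le> g i" using insert.prems by (auto intro: sum_nonneg)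
  then have "g i \<noteq> - \<infinity>" "(\<Sum>i\<in>I. g i) \<noteq> - \<infinity>" by auto
  then have "((\<lambda>x. f i x + (\<Sum>i\<in>I. f i x)) \<longlongrightarrow> g i + (\<Sum>i\<in>I. g i)) F"
    using insert by (intro tendsto_add_ereal_nonneg) auto
  then show ?case using insert by simp
qed auto

context
  fixes V :: "real \<Rightarrow> ereal"
  assumes adm: "admissible_potential V"
begin

lemma phi_window_nonneg:
  assumes "k \<ge> 1" "\<And>l. 1 \<le> l \<Longrightarrow> - 1 \<le> x l"
  shows "0 \<le> \<phi> V k (\<Sum>l=j+1..j+k. x l)"
  using assms by (intro phi_nonneg[OF adm] window_ge) auto

lemma E_eq:
  assumes x: "x \<in> Dom_E n"
  shows "E V n x = (\<Sum>k=1..n. \<Sum>j=0..n-k. \<phi> V k (\<Sum>l=j+1..j+k. x l))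
    + ereal (\<Sum>l=1..n. sigma_n V n l * x l)"
proof -
  \<comment> \<open>Moving terms across is legitimate because only \<open>V (real k + s)\<close> can
    be infinite.\<close>
  have split: "V (real k + s) - V (real k) = \<phi> V k s + ereal (V1 V (real k) * s)" if "k \<ge> 1" for k s
    using potential_ereal[OF adm, of "real k"] that
    by (cases "V (real k + s)"; cases "V (real k)") (auto simp: \<phi>_def)
  have "E V n x = (\<Sum>k=1..n. \<Sum>j=0..n-k. \<phi> V k (\<Sum>l=j+1..j+k. x l)
      + ereal (V1 V (real k) * (\<Sum>l=j+1..j+k. x l)))"
    unfolding E_def using x by (simp add: split cong: sum.cong_simp)
  also have "\<dots> = (\<Sum>k=1..n. \<Sum>j=0..n-k. \<phi> V k (\<Sum>l=j+1..j+k. x l))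
      + ereal (\<Sum>k=1..n. \<Sum>j=0..n-k. V1 V (real k) * (\<Sum>l=j+1..j+k. x l))"
    by (simp only: sum.distrib sum_ereal)
  also have "(\<Sum>k=1..n. \<Sum>j=0..n-k. V1 V (real k) * (\<Sum>l=j+1..j+k. x l)) = (\<Sum>l=1..n. sigma_n V n l * x l)"
    using x V1_neg[OF adm] by (intro linear_part_eq) (auto simp: Dom_E_def)
  finally show ?thesis .
qed

section \<open>Convergence of the boundary forces\<close>

text \<open>Replacing \<open>min k (n + 1 - k)\<close> by \<open>k\<close> and summing over all
  \<open>k\<close> can only increase the force. The bound does not depend on \<open>n\<close> once
  the distance to the nearer end is fixed.\<close>

lemma sigma_n_le:
  assumes "1 \<le> l" "l \<le> n"
  shows "sigma_n V n l \<le> \<sigma>_inf V (min l (n + 1 - l))"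
proof -
  let ?i = "min l (n + 1 - l)"
  have "sigma_n V n l \<le> (\<Sum>k=1..n. \<bar>V1 V (real k)\<bar> * real (k - ?i))"
    unfolding sigma_n_def by (intro sum_mono mult_left_mono) auto
  also have "\<dots> \<le> (\<Sum>k. \<bar>V1 V (real k)\<bar> * real (k - ?i))"
    by (intro sum_le_suminf summable_sigma_inf_terms[OF adm]) auto
  also have "\<dots> = \<sigma>_inf V ?i"
    by (rule sigma_inf_eq[OF adm, symmetric]) (use assms in auto)
  finally show ?thesis .
qed

lemma sigma_n_tendsto:
  assumes i: "i \<ge> 1"
  shows "(\<lambda>n. sigma_n V n i) \<longlonglongrightarrow> \<sigma>_inf V i"
proof -
  define a where "a = (\<lambda>k n. if 1 \<le> k \<and> k \<le> n
    then \<bar>V1 V (real k)\<bar> * real (min k (n + 1 - k) - min i (n + 1 - i)) else 0)"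
  have "sigma_n V n i = (\<Sum>k. a k n)" for n
  proof -
    have "(\<Sum>k. a k n) = (\<Sum>k=1..n. a k n)"
      by (rule suminf_finite) (auto simp: a_def)
    then show ?thesis by (simp add: sigma_n_def a_def)
  qed
  moreover have "(\<lambda>n. \<Sum>k. a k n) \<longlonglongrightarrow> (\<Sum>k. \<bar>V1 V (real k)\<bar> * real (k - i))"
  proof (rule tannerys_theorem[THEN conjunct2, THEN conjunct2])
    show "(\<lambda>n. a k n) \<longlonglongrightarrow> \<bar>V1 V (real k)\<bar> * real (k - i)" for k
    proof (rule tendsto_eventually)
      show "\<forall>\<^sub>F n in sequentially. a k n = \<bar>V1 V (real k)\<bar> * real (k - i)"
        \<comment> \<open>From here on both minima are attained at the left end, so the term no
          longer depends on \<open>n\<close>.\<close>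
        using eventually_ge_at_top[of "2 * k + 2 * i"] by eventually_elim (auto simp: a_def)
    qed
    show "\<forall>\<^sub>F (k, n) in sequentially \<times>\<^sub>F sequentially. norm (a k n) \<le> \<bar>V1 V (real k)\<bar> * real k"
      by (intro always_eventually) (auto simp: a_def abs_mult intro!: mult_left_mono)
    show "summable (\<lambda>k. \<bar>V1 V (real k)\<bar> * real k)"
      by (rule summable_V1_moment[OF adm])
  qed simp
  ultimately show ?thesis by (simp add: sigma_inf_eq[OF adm i])
qed

lemma inner_half_le:
  assumes "x \<in> Dom_E n"
  shows "ell2_inner (left_half n x) (left_half n x) \<le> ell2_inner x x"
    and "ell2_inner (right_half n x) (right_half n x) \<le> ell2_inner x x"
proof -
  let ?h = "(n + 1) div 2"
  have half: "ell2_inner (left_half n y) (left_half n y) = (\<Sum>i=1..?h. (y i)\<^sup>2)" for y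
    by (subst ell2_inner_finite_support[of ?h]) (auto simp: left_half_eq power2_eq_square)
  have "(\<Sum>i=1..?h. (x i)\<^sup>2) \<le> (\<Sum>l=1..n. (x l)\<^sup>2)"
    by (rule sum_mono2) auto
  then show "ell2_inner (left_half n x) (left_half n x) \<le> ell2_inner x x"
    using half Dom_E_inner_self[OF assms] by simp
  have "(\<Sum>i=1..?h. (x (n + 1 - i))\<^sup>2) = (\<Sum>l=n+1-?h..n. (x l)\<^sup>2)"
    by (rule sum.reindex_bij_witness[of _ "\<lambda>l. n + 1 - l" "\<lambda>l. n + 1 - l"]) auto
  also have "\<dots> \<le> (\<Sum>l=1..n. (x l)\<^sup>2)"
    by (rule sum_mono2) auto
  finally show "ell2_inner (right_half n x) (right_half n x) \<le> ell2_inner x x"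
    using half Dom_E_inner_self[OF assms] by (simp add: right_half_eq)
qed

text \<open>Cauchy-Schwarz on each half bounds the error by the norm of \<open>d n\<close>; the two
  halves give the factor \<open>2\<close>. Keeping the norm of \<open>x\<close> in the estimate
  makes it usable for both the lower and the upper bound.\<close>

lemma linear_part_approx:
  obtains \<delta> :: "nat \<Rightarrow> real" where "\<delta> \<longlonglongrightarrow> 0"
    "\<And>n x. x \<in> Dom_E n \<Longrightarrow>
      \<bar>(\<Sum>l=1..n. sigma_n V n l * x l)
        - (ell2_inner (\<sigma>_inf V) (left_half n x) + ell2_inner (\<sigma>_inf V) (right_half n x))\<bar>
      \<le> \<delta> n * sqrt (ell2_inner x x)"
proof -
  define d where "d = (\<lambda>n i. if 1 \<le> i \<and> i \<le> (n + 1) div 2 then sigma_n V n i - \<sigma>_inf V i else 0)"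
  have d_ell2: "d n \<in> ell2" for n
    by (rule ell2_finite_support[of _ "(n + 1) div 2"]) (auto simp: d_def)
  have "(\<lambda>n. ell2_inner (d n) (d n)) \<longlonglongrightarrow> 0"
  proof (rule tannery_sum_squares_tendsto_0)
    fix i
    have "(\<lambda>n. sigma_n V n i - \<sigma>_inf V i) \<longlonglongrightarrow> 0" if "i \<ge> 1"
      using tendsto_diff[OF sigma_n_tendsto[OF that] tendsto_const[of "\<sigma>_inf V i"]] by simp
    moreover have "(\<lambda>n. sigma_n V n i - \<sigma>_inf V i) \<longlonglongrightarrow> 0 \<Longrightarrow> (\<lambda>n. d n i) \<longlonglongrightarrow> 0" if "i \<ge> 1"
    proof (erule Lim_transform_eventually)
      show "\<forall>\<^sub>F n in sequentially. sigma_n V n i - \<sigma>_inf V i = d n i"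
        using eventually_ge_at_top[of "2 * i"] by eventually_elim (use that in \<open>auto simp: d_def\<close>)
    qed
    ultimately show "(\<lambda>n. d n i) \<longlonglongrightarrow> 0"
      by (cases "i \<ge> 1") (auto simp: d_def)
  next
    fix n i
    have "sigma_n V n i \<le> \<sigma>_inf V i" if "1 \<le> i" "i \<le> (n + 1) div 2"
    proof -
      have "i \<le> n" "min i (n + 1 - i) = i" using that by auto
      then show ?thesis using sigma_n_le[of i n] that by simp
    qed
    then show "\<bar>d n i\<bar> \<le> \<sigma>_inf V i"
      using sigma_n_nonneg[of V n i] sigma_inf_nonneg[OF adm, of i] by (auto simp: d_def)
  qed (rule sigma_inf_ell2[OF adm])
  then have "(\<lambda>n. 2 * sqrt (ell2_inner (d n) (d n))) \<longlonglongrightarrow> 2 * sqrt 0"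
    by (intro tendsto_intros)
  then have lim: "(\<lambda>n. 2 * sqrt (ell2_inner (d n) (d n))) \<longlonglongrightarrow> 0" by simp
  show ?thesis
  proof (rule that[OF lim])
    fix n x assume x: "x \<in> Dom_E n"
    let ?h = "(n + 1) div 2" and ?s = "sqrt (ell2_inner (d n) (d n))"
    have half: "(\<Sum>i=1..?h. sigma_n V n i * y i) - ell2_inner (\<sigma>_inf V) y = ell2_inner (d n) y"
      if "\<And>i. i > ?h \<Longrightarrow> y i = 0" for y
    proof -
      have 1: "ell2_inner (\<sigma>_inf V) y = (\<Sum>i=1..?h. y i * \<sigma>_inf V i)"
        using that ell2_inner_finite_support[of ?h y "\<sigma>_inf V"]
        by (simp add: ell2_inner_def mult.commute \<sigma>_inf_def)
      have 2: "ell2_inner (d n) y = (\<Sum>i=1..?h. d n i * y i)"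
        by (rule ell2_inner_finite_support) (auto simp: d_def)
      show ?thesis unfolding 1 2 sum_subtractf[symmetric]
        by (rule sum.cong) (auto simp: d_def algebra_simps)
    qed
    have err: "\<bar>ell2_inner (d n) y\<bar> \<le> ?s * sqrt (ell2_inner x x)"
      if "y \<in> ell2" "ell2_inner y y \<le> ell2_inner x x" for y
    proof -
      have "\<bar>ell2_inner (d n) y\<bar> \<le> ?s * sqrt (ell2_inner y y)"
        by (rule ell2_Cauchy_Schwarz[OF d_ell2 that(1)])
      also have "\<dots> \<le> ?s * sqrt (ell2_inner x x)"
        using that(2) ell2_inner_self_nonneg[OF d_ell2] by (intro mult_left_mono) auto
      finally show ?thesis .
    qed
    let ?L = "left_half n x" and ?R = "right_half n x"
    have "(\<Sum>l=1..n. sigma_n V n l * x l) - (ell2_inner (\<sigma>_inf V) ?L + ell2_inner (\<sigma>_inf V) ?R)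
        = ell2_inner (d n) ?L + ell2_inner (d n) ?R"
      using half[of ?L] half[of ?R] sum_sigma_n_eq_halves[of V n x]
      by (simp add: left_half_eq right_half_eq)
    also have "\<bar>\<dots>\<bar> \<le> ?s * sqrt (ell2_inner x x) + ?s * sqrt (ell2_inner x x)"
      using inner_half_le[OF x]
      by (intro order_trans[OF abs_triangle_ineq] add_mono err left_half_ell2)
         (auto simp: right_half_eq left_half_ell2)
    finally show "\<bar>(\<Sum>l=1..n. sigma_n V n l * x l)
        - (ell2_inner (\<sigma>_inf V) ?L + ell2_inner (\<sigma>_inf V) ?R)\<bar> \<le> 2 * ?s * sqrt (ell2_inner x x)"
      by (simp only: mult_2 distrib_right)
  qed
qed

section \<open>Compactness\<close>

text \<open>For \<open>y \<ge> 0\<close> the force term has the good sign. For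
  \<open>-1 \<le> y < 0\<close> the minimum is \<open>y\<^sup>2\<close>, and the claim is that
  \<open>(c * y + s)\<^sup>2 / (2 * c)\<close> is nonnegative.\<close>

lemma young_truncated:
  fixes c s y :: real
  assumes "c > 0" "s \<ge> 0" "y \<ge> -1"
  shows "c / 2 * min (y\<^sup>2) \<bar>y\<bar> - s\<^sup>2 / (2 * c) \<le> c * min (y\<^sup>2) \<bar>y\<bar> + s * y"
proof (cases "y \<ge> 0")
  case True
  have "0 \<le> min (y\<^sup>2) \<bar>y\<bar>" by simp
  then have "c / 2 * min (y\<^sup>2) \<bar>y\<bar> \<le> c * min (y\<^sup>2) \<bar>y\<bar>"
    using assms by (intro mult_right_mono) auto
  moreover have "0 \<le> s * y" "0 \<le> s\<^sup>2 / (2 * c)" using assms True by auto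
  ultimately show ?thesis by linarith
next
  case False
  have "y\<^sup>2 \<le> \<bar>y\<bar>"
    using False assms(3) mult_left_mono[of "\<bar>y\<bar>" 1 "\<bar>y\<bar>"] by (simp add: power2_eq_square)
  moreover have "0 \<le> (c * y + s)\<^sup>2 / (2 * c)" using assms by simp
  then have "c / 2 * y\<^sup>2 - s\<^sup>2 / (2 * c) \<le> c * y\<^sup>2 + s * y"
    using assms(1) by (simp add: power2_eq_square field_simps)
  ultimately show ?thesis by (simp add: min_absorb1)
qed

text \<open>The bound depends on the energy level only, not on \<open>n\<close>. It serves
  compactness and also the linear part in the liminf inequality.\<close>

lemma E_bounded_imp_inner_bounded:
  obtains R :: "real \<Rightarrow> real" where
    "\<And>C n x. x \<in> Dom_E n \<Longrightarrow> E V n x \<le> ereal C \<Longrightarrow> ell2_inner x x \<le> R C"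
proof -
  obtain c where c: "c > 0" "\<And>y. y \<ge> -1 \<Longrightarrow> ereal (c * min (y\<^sup>2) \<bar>y\<bar>) \<le> \<phi> V 1 y"
    using phi_1_lower_bound[OF adm] by blast
  define S where "S = ell2_inner (\<sigma>_inf V) (\<sigma>_inf V)"
  \<comment> \<open>The forces have total square mass at most \<open>2 * S\<close>, and Young's
    inequality charges \<open>1 / (2 * c)\<close> of it, hence \<open>S / c\<close>.\<close>
  define M where "M = (\<lambda>C. (C + S / c) / (c / 2))"
  show ?thesis
  proof (rule that)
    fix C n x assume x: "x \<in> Dom_E n" and le: "E V n x \<le> ereal C"
    let ?m = "\<lambda>l. min ((x l)\<^sup>2) \<bar>x l\<bar>"
    have ge: "- 1 \<le> x l" if "1 \<le> l" for l using Dom_E_ge[OF x that] .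
    have "ereal (\<Sum>l=1..n. c * ?m l) \<le> (\<Sum>l=1..n. \<phi> V 1 (x l))"
      unfolding sum_ereal[symmetric] using ge c(2) by (intro sum_mono) auto
    also have "\<dots> \<le> (\<Sum>k=1..n. \<Sum>j=0..n-k. \<phi> V k (\<Sum>l=j+1..j+k. x l))"
    proof (cases "n = 0")
      case False
      have "(\<Sum>l=1..n. \<phi> V 1 (x l)) = (\<Sum>j=0..n-1. \<phi> V 1 (x (j + 1)))"
        by (rule sum.reindex_bij_witness[of _ "\<lambda>j. j + 1" "\<lambda>l. l - 1"]) (use False in auto)
      also have "\<dots> = (\<Sum>k\<in>{1}. \<Sum>j=0..n-k. \<phi> V k (\<Sum>l=j+1..j+k. x l))"
        by simp
      also have "\<dots> \<le> (\<Sum>k=1..n. \<Sum>j=0..n-k. \<phi> V k (\<Sum>l=j+1..j+k. x l))"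
        using False ge by (intro sum_mono2 sum_nonneg phi_window_nonneg) auto
      finally show ?thesis .
    qed simp
    finally have "ereal (\<Sum>l=1..n. c * ?m l) + ereal (\<Sum>l=1..n. sigma_n V n l * x l) \<le> E V n x"
      unfolding E_eq[OF x] by (rule add_right_mono)
    also note le
    finally have "(\<Sum>l=1..n. c * ?m l + sigma_n V n l * x l) \<le> C"
      by (simp add: sum.distrib)
    moreover have "(\<Sum>l=1..n. c / 2 * ?m l - (sigma_n V n l)\<^sup>2 / (2 * c))
        \<le> (\<Sum>l=1..n. c * ?m l + sigma_n V n l * x l)"
      using ge c sigma_n_nonneg by (intro sum_mono young_truncated) auto
    ultimately have "c / 2 * (\<Sum>l=1..n. ?m l) - (\<Sum>l=1..n. (sigma_n V n l)\<^sup>2) / (2 * c) \<le> C"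
      by (simp add: sum_subtractf sum_distrib_left sum_divide_distrib)
    \<comment> \<open>Each site is charged to both ends, each end contributing at most
      \<open>S\<close>.\<close>
    moreover have "(\<Sum>l=1..n. (sigma_n V n l)\<^sup>2) \<le> 2 * S"
    proof -
      have "(\<Sum>l=1..n. (sigma_n V n l)\<^sup>2) \<le> (\<Sum>l=1..n. (\<sigma>_inf V l)\<^sup>2 + (\<sigma>_inf V (n + 1 - l))\<^sup>2)"
      proof (rule sum_mono)
        fix l assume l: "l \<in> {1..n}"
        have "(sigma_n V n l)\<^sup>2 \<le> (\<sigma>_inf V (min l (n + 1 - l)))\<^sup>2"
          using l sigma_n_le sigma_n_nonneg by (intro power_mono) auto
        also have "\<dots> \<le> (\<sigma>_inf V l)\<^sup>2 + (\<sigma>_inf V (n + 1 - l))\<^sup>2"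
          by (simp add: min_def)
        finally show "(sigma_n V n l)\<^sup>2 \<le> (\<sigma>_inf V l)\<^sup>2 + (\<sigma>_inf V (n + 1 - l))\<^sup>2" .
      qed
      also have "\<dots> = (\<Sum>l=1..n. (\<sigma>_inf V l)\<^sup>2) + (\<Sum>l=1..n. (\<sigma>_inf V (n + 1 - l))\<^sup>2)"
        by (rule sum.distrib)
      also have "(\<Sum>l=1..n. (\<sigma>_inf V (n + 1 - l))\<^sup>2) = (\<Sum>l=1..n. (\<sigma>_inf V l)\<^sup>2)"
        by (rule sum.reindex_bij_witness[of _ "\<lambda>l. n + 1 - l" "\<lambda>l. n + 1 - l"]) auto
      also have "(\<Sum>l=1..n. (\<sigma>_inf V l)\<^sup>2) \<le> S"
        unfolding S_def by (intro sum_le_ell2_inner sigma_inf_ell2[OF adm]) auto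
      finally show ?thesis by simp
    qed
    then have "(\<Sum>l=1..n. (sigma_n V n l)\<^sup>2) / (2 * c) \<le> S / c"
      using c(1) by (simp add: field_simps)
    ultimately have "c / 2 * (\<Sum>l=1..n. ?m l) \<le> C + S / c" by linarith
    then have sum_m: "(\<Sum>l=1..n. ?m l) \<le> M C"
      unfolding M_def using c(1) by (simp add: field_simps)
    \<comment> \<open>Linear growth still suffices: the sum bounds every single term, so large
      entries are uniformly bounded and their squares are controlled by their absolute
      values.\<close>
    have "(x l)\<^sup>2 \<le> ?m l * max 1 (M C)" if "l \<in> {1..n}" for l
    proof (cases "\<bar>x l\<bar> \<le> 1")
      case True
      then have "?m l = (x l)\<^sup>2"
        using mult_left_mono[of "\<bar>x l\<bar>" 1 "\<bar>x l\<bar>"] by (simp add: power2_eq_square)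
      moreover have "(x l)\<^sup>2 * 1 \<le> (x l)\<^sup>2 * max 1 (M C)" by (intro mult_left_mono) auto
      ultimately show ?thesis by simp
    next
      case False
      then have m: "?m l = \<bar>x l\<bar>"
        using mult_left_mono[of 1 "\<bar>x l\<bar>" "\<bar>x l\<bar>"] by (simp add: power2_eq_square)
      have "?m l \<le> (\<Sum>l=1..n. ?m l)" by (rule member_le_sum) (use that in auto)
      then have "\<bar>x l\<bar> \<le> max 1 (M C)" using sum_m m by linarith
      then have "\<bar>x l\<bar> * \<bar>x l\<bar> \<le> \<bar>x l\<bar> * max 1 (M C)" by (intro mult_left_mono) auto
      then show ?thesis unfolding m by (simp add: power2_eq_square)
    qed
    then have "(\<Sum>l=1..n. (x l)\<^sup>2) \<le> (\<Sum>l=1..n. ?m l) * max 1 (M C)"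
      unfolding sum_distrib_right by (intro sum_mono)
    also have "\<dots> \<le> M C * max 1 (M C)"
      using sum_m by (intro mult_right_mono) auto
    finally show "ell2_inner x x \<le> M C * max 1 (M C)"
      unfolding Dom_E_inner_self[OF x] .
  qed
qed

section \<open>The liminf inequality\<close>

text \<open>With \<open>4 * K \<le> n\<close>, windows of length at most \<open>K\<close> starting
  within the first \<open>K\<close> sites stay in the left half, and their mirror images stay in the
  right half. The two families are disjoint, and the remaining terms are nonnegative.\<close>

lemma square_sums_le:
  assumes ge: "\<And>l. 1 \<le> l \<Longrightarrow> - 1 \<le> x l" and n: "4 * K \<le> n"
  shows "(\<Sum>k<K. \<Sum>j<K. \<phi> V (Suc k) (\<Sum>l=j+1..Suc k+j. left_half n x l))
      + (\<Sum>k<K. \<Sum>j<K. \<phi> V (Suc k) (\<Sum>l=j+1..Suc k+j. right_half n x l))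
    \<le> (\<Sum>k=1..n. \<Sum>j=0..n-k. \<phi> V k (\<Sum>l=j+1..j+k. x l))"
proof -
  let ?w = "\<lambda>k j. \<phi> V k (\<Sum>l=j+1..j+k. x l)"
  have nonneg: "0 \<le> ?w k j" if "k \<ge> 1" for k j
    using phi_window_nonneg[OF that ge] .
  have "(\<Sum>k<K. \<Sum>j<K. \<phi> V (Suc k) (\<Sum>l=j+1..Suc k+j. left_half n x l))
      + (\<Sum>k<K. \<Sum>j<K. \<phi> V (Suc k) (\<Sum>l=j+1..Suc k+j. right_half n x l))
    \<le> (\<Sum>k<K. \<Sum>j=0..n-Suc k. ?w (Suc k) j)"
  proof (subst sum.distrib[symmetric], rule sum_mono)
    fix k assume k: "k \<in> {..<K}"
    let ?r = "\<lambda>j. n - Suc k - j"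
    have "(\<Sum>l=j+1..Suc k+j. left_half n x l) = (\<Sum>l=j+1..j+Suc k. x l)" if "j < K" for j
      by (rule sum.cong) (use that k n in \<open>auto simp: left_half_eq\<close>)
    then have left: "(\<Sum>j<K. \<phi> V (Suc k) (\<Sum>l=j+1..Suc k+j. left_half n x l)) = (\<Sum>j<K. ?w (Suc k) j)"
      by (intro sum.cong) auto
    have "(\<Sum>l=j+1..Suc k+j. right_half n x l) = (\<Sum>l=?r j+1..?r j+Suc k. x l)" if "j < K" for j
    proof -
      have "(\<Sum>l=j+1..Suc k+j. right_half n x l) = (\<Sum>l=j+1..j+Suc k. x (n + 1 - l))"
        by (rule sum.cong) (use that k n in \<open>auto simp: right_half_eq left_half_eq\<close>)
      also have "\<dots> = (\<Sum>l=?r j+1..?r j+Suc k. x l)"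
        by (rule window_reflect) (use that k n in auto)
      finally show ?thesis .
    qed
    then have "(\<Sum>j<K. \<phi> V (Suc k) (\<Sum>l=j+1..Suc k+j. right_half n x l)) = (\<Sum>j<K. ?w (Suc k) (?r j))"
      by (intro sum.cong) auto
    also have "\<dots> = (\<Sum>j\<in>?r ` {..<K}. ?w (Suc k) j)"
      by (rule sum.reindex[unfolded o_def, symmetric]) (use k n in \<open>auto simp: inj_on_def\<close>)
    finally have "(\<Sum>j<K. \<phi> V (Suc k) (\<Sum>l=j+1..Suc k+j. left_half n x l))
        + (\<Sum>j<K. \<phi> V (Suc k) (\<Sum>l=j+1..Suc k+j. right_half n x l))
        = (\<Sum>j\<in>{..<K} \<union> ?r ` {..<K}. ?w (Suc k) j)"
      unfolding left by (subst sum.union_disjoint) (use k n in auto)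
    also have "\<dots> \<le> (\<Sum>j=0..n-Suc k. ?w (Suc k) j)"
    proof (rule sum_mono2)
      show "{..<K} \<union> ?r ` {..<K} \<subseteq> {0..n-Suc k}" using k n by auto
      show "0 \<le> ?w (Suc k) j" for j by (rule nonneg) simp
    qed simp
    finally show "(\<Sum>j<K. \<phi> V (Suc k) (\<Sum>l=j+1..Suc k+j. left_half n x l))
        + (\<Sum>j<K. \<phi> V (Suc k) (\<Sum>l=j+1..Suc k+j. right_half n x l))
      \<le> (\<Sum>j=0..n-Suc k. ?w (Suc k) j)" .
  qed
  also have "\<dots> = (\<Sum>k=1..K. \<Sum>j=0..n-k. ?w k j)"
    by (rule sum.reindex_bij_witness[of _ "\<lambda>k. k - 1" Suc]) auto
  also have "\<dots> \<le> (\<Sum>k=1..n. \<Sum>j=0..n-k. ?w k j)"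
    by (rule sum_mono2) (use n nonneg in \<open>auto intro!: sum_nonneg\<close>)
  finally show ?thesis .
qed

lemma E_inf_term_nonneg:
  assumes "\<And>i. i \<ge> 1 \<Longrightarrow> - 1 \<le> x i"
  shows "0 \<le> \<phi> V (Suc k) (\<Sum>l=j+1..Suc k+j. x l)"
  using phi_window_nonneg[of "Suc k" x j] assms by (simp add: add.commute)

lemma phi_window_tendsto:
  assumes "weak_conv X x"
  shows "(\<lambda>n. \<phi> V (Suc k) (\<Sum>l=j+1..Suc k+j. X n l)) \<longlonglongrightarrow> \<phi> V (Suc k) (\<Sum>l=j+1..Suc k+j. x l)"
  by (intro phi_tendsto[OF adm] tendsto_sum weak_conv_pointwise[OF assms]) auto

lemma ell2_inner_sigma_inf_add:
  assumes "\<epsilon> \<in> ell2" "\<eta> \<in> ell2"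
  shows "ell2_inner (\<sigma>_inf V) (\<lambda>i. \<epsilon> i + \<eta> i) = ell2_inner (\<sigma>_inf V) \<epsilon> + ell2_inner (\<sigma>_inf V) \<eta>"
  unfolding ell2_inner_def distrib_left
  using sigma_inf_ell2[OF adm] assms by (intro suminf_add[symmetric] ell2_summable_mult)

lemma liminf_inequality:
  assumes dom: "(\<epsilon>, \<eta>) \<in> Dom_E_inf"
    and X: "\<And>n. n \<ge> 1 \<Longrightarrow> X n \<in> Dom_E n" and conv: "weak_conv2 X (\<epsilon>, \<eta>)"
  shows "E_inf V (\<epsilon>, \<eta>) \<le> liminf (\<lambda>n. E V n (X n))"
proof -
  let ?L = "\<lambda>n. left_half n (X n)" and ?R = "\<lambda>n. right_half n (X n)"
  let ?f = "\<lambda>x k j. \<phi> V (Suc k) (\<Sum>l=j+1..Suc k+j. x l)"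
  have \<epsilon>: "\<epsilon> \<in> ell2" "\<And>i. i \<ge> 1 \<Longrightarrow> - 1 \<le> \<epsilon> i" and \<eta>: "\<eta> \<in> ell2" "\<And>i. i \<ge> 1 \<Longrightarrow> - 1 \<le> \<eta> i"
    using dom by (auto simp: Dom_E_inf_def)
  have L: "weak_conv ?L \<epsilon>" and R: "weak_conv ?R \<eta>"
    using conv by (auto simp: weak_conv2_def)
  obtain B where B: "\<And>C n x. x \<in> Dom_E n \<Longrightarrow> E V n x \<le> ereal C \<Longrightarrow> ell2_inner x x \<le> B C"
    using E_bounded_imp_inner_bounded by blast
  obtain \<delta> where \<delta>: "\<delta> \<longlonglongrightarrow> 0" "\<And>n x. x \<in> Dom_E n \<Longrightarrow>
      \<bar>(\<Sum>l=1..n. sigma_n V n l * x l)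
        - (ell2_inner (\<sigma>_inf V) (left_half n x) + ell2_inner (\<sigma>_inf V) (right_half n x))\<bar>
      \<le> \<delta> n * sqrt (ell2_inner x x)"
    using linear_part_approx by blast
  let ?r = "\<lambda>n. ell2_inner (\<sigma>_inf V) (?L n) + ell2_inner (\<sigma>_inf V) (?R n)"
  let ?s = "ell2_inner (\<sigma>_inf V) (\<lambda>i. \<epsilon> i + \<eta> i)"
  have r_lim: "?r \<longlonglongrightarrow> ?s"
    unfolding ell2_inner_sigma_inf_add[OF \<epsilon>(1) \<eta>(1)]
    unfolding ell2_inner_commute[of "\<sigma>_inf V"]
    using L R sigma_inf_ell2[OF adm] by (intro tendsto_add) (auto simp: weak_conv_def)
  show ?thesis
    unfolding le_Liminf_iff
  proof (intro allI impI)
    fix y assume "y < E_inf V (\<epsilon>, \<eta>)"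
    then obtain c where yc: "y < ereal c" and "ereal c < E_inf V (\<epsilon>, \<eta>)"
      using ereal_dense2 by blast
    \<comment> \<open>The gap \<open>c' - c\<close> is reserved for the error of the linear
      part.\<close>
    then obtain c' where "ereal c < ereal c'" and c': "ereal c' < E_inf V (\<epsilon>, \<eta>)"
      using ereal_dense2 by blast
    then have cc': "c < c'" by simp
    from c' have "ereal c' < (\<Sum>k. \<Sum>j. ?f \<epsilon> k j) + (\<Sum>k. \<Sum>j. ?f \<eta> k j) + ereal ?s"
      by (simp add: E_inf_def)
    then obtain K where K: "ereal c' < (\<Sum>k<K. \<Sum>j<K. ?f \<epsilon> k j) + (\<Sum>k<K. \<Sum>j<K. ?f \<eta> k j) + ereal ?s"
      using less_double_series_add[of "?f \<epsilon>" "?f \<eta>", OF E_inf_term_nonneg[OF \<epsilon>(2)] E_inf_term_nonneg[OF \<eta>(2)]]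
      by blast
    let ?P = "\<lambda>x. \<Sum>k<K. \<Sum>j<K. ?f x k j"
    have P_nonneg: "0 \<le> ?P x" if "\<And>i. i \<ge> 1 \<Longrightarrow> - 1 \<le> x i" for x
      using E_inf_term_nonneg[OF that] by (intro sum_nonneg) auto
    have P_lim: "(\<lambda>n. ?P (Y n)) \<longlonglongrightarrow> ?P x" if "weak_conv Y x" "\<And>i. i \<ge> 1 \<Longrightarrow> - 1 \<le> x i" for Y x
      using E_inf_term_nonneg[OF that(2)]
      by (intro tendsto_sum_ereal_nonneg phi_window_tendsto[OF that(1)] sum_nonneg) auto
    have "(\<lambda>n. ?P (?L n) + ?P (?R n) + ereal (?r n)) \<longlonglongrightarrow> ?P \<epsilon> + ?P \<eta> + ereal ?s"
    proof (intro tendsto_add_ereal_nonneg P_lim[OF L] P_lim[OF R])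
      show "?P \<epsilon> \<noteq> - \<infinity>" "?P \<eta> \<noteq> - \<infinity>" "?P \<epsilon> + ?P \<eta> \<noteq> - \<infinity>"
        using P_nonneg[of \<epsilon>] P_nonneg[of \<eta>] \<epsilon>(2) \<eta>(2) by auto
      show "(\<lambda>n. ereal (?r n)) \<longlonglongrightarrow> ereal ?s" using r_lim by simp
    qed (use \<epsilon>(2) \<eta>(2) in auto)
    then have ev1: "\<forall>\<^sub>F n in sequentially. ereal c' < ?P (?L n) + ?P (?R n) + ereal (?r n)"
      using K by (rule order_tendstoD(1))
    have "(\<lambda>n. \<bar>\<delta> n\<bar> * sqrt \<bar>B c\<bar>) \<longlonglongrightarrow> \<bar>0\<bar> * sqrt \<bar>B c\<bar>"
      by (intro tendsto_intros \<delta>(1))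
    then have ev2: "\<forall>\<^sub>F n in sequentially. \<bar>\<delta> n\<bar> * sqrt \<bar>B c\<bar> < c' - c"
      using cc' by (intro order_tendstoD(2)) auto
    show "\<forall>\<^sub>F n in sequentially. y < E V n (X n)"
      using ev1 ev2 eventually_ge_at_top[of 1] eventually_ge_at_top[of "4 * K"]
    proof eventually_elim
      case (elim n)
      have Xn: "X n \<in> Dom_E n" using X elim(3) by simp
      have "ereal c < E V n (X n)"
      proof (rule ccontr)
        \<comment> \<open>Either the energy already exceeds \<open>c\<close>, or it is at most
          \<open>c\<close> and then \<open>B c\<close> bounds the norm of \<open>X n\<close>, which
          makes the error estimate effective.\<close>
        assume "\<not> ereal c < E V n (X n)"
        then have le: "E V n (X n) \<le> ereal c" by simp
        have "\<delta> n * sqrt (ell2_inner (X n) (X n)) \<le> \<bar>\<delta> n\<bar> * sqrt \<bar>B c\<bar>"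
        proof -
          have "0 \<le> ell2_inner (X n) (X n)"
            using Xn by (intro ell2_inner_self_nonneg) (simp add: Dom_E_def)
          then show ?thesis
            using B[OF Xn le] by (intro mult_mono real_sqrt_le_mono) auto
        qed
        then have lin: "?r n - (c' - c) \<le> (\<Sum>l=1..n. sigma_n V n l * X n l)"
          using \<delta>(2)[OF Xn] elim(2) by linarith
        have "?P (?L n) + ?P (?R n) + ereal (?r n - (c' - c)) \<le> E V n (X n)"
          unfolding E_eq[OF Xn]
          using square_sums_le[OF Dom_E_ge[OF Xn] elim(4)] lin by (intro add_mono) auto
        then have "?P (?L n) + ?P (?R n) + ereal (?r n - (c' - c)) \<le> ereal c"
          using le by (rule order_trans)
        moreover have False if "ereal c' < Q + ereal r" "Q + ereal (r - (c' - c)) \<le> ereal c" for Q r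
          using that by (cases Q) auto
        ultimately show False using elim(1) by blast
      qed
      with yc show ?case by (rule less_trans)
    qed
  qed
qed

end

section \<open>Recovery sequences\<close>

definition tail_mass :: "(nat \<Rightarrow> real) \<Rightarrow> nat \<Rightarrow> real" where
  "tail_mass x p = (\<Sum>i. (x (i + p))\<^sup>2)"

lemma tail_mass_tendsto_0: "x \<in> ell2 \<Longrightarrow> tail_mass x \<longlonglongrightarrow> 0"
  unfolding tail_mass_def[abs_def] using suminf_exist_split2[of "\<lambda>i. (x i)\<^sup>2"] by (simp add: ell2_def)

lemma summable_tail: "x \<in> ell2 \<Longrightarrow> summable (\<lambda>i. (x (i + p))\<^sup>2)"
  by (subst summable_iff_shift[of "\<lambda>i. (x i)\<^sup>2"]) (simp add: ell2_def)

lemma sum_le_tail_mass: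
  assumes "x \<in> ell2" "finite A" "A \<subseteq> {p..}"
  shows "(\<Sum>l\<in>A. (x l)\<^sup>2) \<le> tail_mass x p"
proof -
  have "(\<Sum>l\<in>A. (x l)\<^sup>2) = (\<Sum>i\<in>(\<lambda>l. l - p) ` A. (x (i + p))\<^sup>2)"
    by (rule sum.reindex_bij_witness[of _ "\<lambda>i. i + p" "\<lambda>l. l - p"]) (use assms(3) in auto)
  also have "\<dots> \<le> tail_mass x p"
    unfolding tail_mass_def using assms by (intro sum_le_suminf summable_tail) auto
  finally show ?thesis .
qed

lemma tail_mass_antimono:
  assumes "x \<in> ell2" "p \<le> q"
  shows "tail_mass x q \<le> tail_mass x p"
proof -
  have "tail_mass x q = (\<Sum>i. (x (i + (q - p) + p))\<^sup>2)"
    unfolding tail_mass_def using assms(2) by (simp add: add.assoc)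
  also have "\<dots> = tail_mass x p - (\<Sum>i<q-p. (x (i + p))\<^sup>2)"
    unfolding tail_mass_def by (rule suminf_minus_initial_segment) (rule summable_tail[OF assms(1)])
  also have "\<dots> \<le> tail_mass x p" by (simp add: sum_nonneg)
  finally show ?thesis .
qed

section \<open>Two half sequences joined by a constant\<close>

definition glued :: "(nat \<Rightarrow> real) \<Rightarrow> (nat \<Rightarrow> real) \<Rightarrow> nat \<Rightarrow> nat \<Rightarrow> real \<Rightarrow> nat \<Rightarrow> real" where
  "glued \<epsilon> \<eta> m n d i =
     (if i = 0 \<or> i > n then 0 else if i \<le> m then \<epsilon> i else if i \<le> n - m then d else \<eta> (n + 1 - i))"

text \<open>Through this symmetry the right half is treated as a left half with
  \<open>\<epsilon>\<close> and \<open>\<eta>\<close> exchanged.\<close>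

lemma glued_reflect:
  assumes "2 * m \<le> n" "1 \<le> i" "i \<le> n"
  shows "glued \<epsilon> \<eta> m n d (n + 1 - i) = glued \<eta> \<epsilon> m n d i"
  using assms by (auto simp: glued_def)

lemma glued_ell2: "glued \<epsilon> \<eta> m n d \<in> ell2"
  by (rule ell2_finite_support[of _ n]) (auto simp: glued_def)

text \<open>Every entry is one of three values, so its square is at most the sum of the three
  squares. The range is symmetric under reflection, hence both tails start at
  \<open>p\<close>.\<close>

lemma glued_mass:
  assumes "\<epsilon> \<in> ell2" "\<eta> \<in> ell2" "1 \<le> p"
  shows "(\<Sum>l=p..n+1-p. (glued \<epsilon> \<eta> m n d l)\<^sup>2) \<le> tail_mass \<epsilon> p + tail_mass \<eta> p + real n * d\<^sup>2"
proof -
  have "(\<Sum>l=p..n+1-p. (glued \<epsilon> \<eta> m n d l)\<^sup>2)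
      \<le> (\<Sum>l=p..n+1-p. (\<epsilon> l)\<^sup>2 + (\<eta> (n + 1 - l))\<^sup>2 + d\<^sup>2)"
    by (rule sum_mono) (auto simp: glued_def)
  also have "\<dots> = (\<Sum>l=p..n+1-p. (\<epsilon> l)\<^sup>2) + (\<Sum>l=p..n+1-p. (\<eta> (n + 1 - l))\<^sup>2)
      + real (card {p..n+1-p}) * d\<^sup>2"
    by (simp add: sum.distrib)
  also have "(\<Sum>l=p..n+1-p. (\<eta> (n + 1 - l))\<^sup>2) = (\<Sum>l=p..n+1-p. (\<eta> l)\<^sup>2)"
    by (rule sum.reindex_bij_witness[of _ "\<lambda>l. n + 1 - l" "\<lambda>l. n + 1 - l"]) (use assms(3) in auto)
  also have "(\<Sum>l=p..n+1-p. (\<epsilon> l)\<^sup>2) + (\<Sum>l=p..n+1-p. (\<eta> l)\<^sup>2) + real (card {p..n+1-p}) * d\<^sup>2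
      \<le> tail_mass \<epsilon> p + tail_mass \<eta> p + real n * d\<^sup>2"
    using assms by (intro add_mono sum_le_tail_mass mult_right_mono) auto
  finally show ?thesis .
qed

lemma glued_sum:
  assumes "2 * m \<le> n"
  shows "(\<Sum>i=1..n. glued \<epsilon> \<eta> m n d i) = (\<Sum>i=1..m. \<epsilon> i + \<eta> i) + real (n - 2 * m) * d"
proof -
  let ?g = "glued \<epsilon> \<eta> m n d"
  have "{1..n} = {1..m} \<union> {m+1..n-m} \<union> {n-m+1..n}" using assms by auto
  then have "(\<Sum>i=1..n. ?g i) = (\<Sum>i\<in>{1..m} \<union> {m+1..n-m} \<union> {n-m+1..n}. ?g i)" by simp
  also have "\<dots> = (\<Sum>i\<in>{1..m} \<union> {m+1..n-m}. ?g i) + (\<Sum>i=n-m+1..n. ?g i)"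
    using assms by (intro sum.union_disjoint) auto
  also have "(\<Sum>i\<in>{1..m} \<union> {m+1..n-m}. ?g i) = (\<Sum>i=1..m. ?g i) + (\<Sum>i=m+1..n-m. ?g i)"
    by (intro sum.union_disjoint) auto
  also have "(\<Sum>i=1..m. ?g i) = (\<Sum>i=1..m. \<epsilon> i)"
    by (rule sum.cong) (use assms in \<open>auto simp: glued_def\<close>)
  also have "(\<Sum>i=m+1..n-m. ?g i) = (\<Sum>i=m+1..n-m. d)"
    by (rule sum.cong) (use assms in \<open>auto simp: glued_def\<close>)
  also have "\<dots> = real (n - 2 * m) * d" by (simp add: mult_2)
  also have "(\<Sum>i=n-m+1..n. ?g i) = (\<Sum>i=n-m+1..n. \<eta> (n + 1 - i))"
    by (rule sum.cong) (use assms in \<open>auto simp: glued_def\<close>)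
  also have "\<dots> = (\<Sum>i=1..m. \<eta> i)"
    by (rule sum.reindex_bij_witness[of _ "\<lambda>l. n + 1 - l" "\<lambda>l. n + 1 - l"]) (use assms in auto)
  finally show ?thesis by (simp add: sum.distrib)
qed

text \<open>The difference vanishes up to \<open>m\<close>; afterwards it is
  \<open>d - \<epsilon> i\<close> inside the half and \<open>- \<epsilon> i\<close> outside.\<close>

lemma glued_left_half_diff:
  fixes \<epsilon> \<eta> :: "nat \<Rightarrow> real" and d :: real
  assumes "\<epsilon> \<in> ell2" "2 * m \<le> n"
  defines "D \<equiv> \<lambda>i. left_half n (glued \<epsilon> \<eta> m n d) i - \<epsilon> i"
  shows "D \<in> ell2" "ell2_inner D D \<le> 2 * (real n * d\<^sup>2) + 2 * tail_mass \<epsilon> (m + 1)"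
proof -
  have eps0: "\<epsilon> 0 = 0" using assms(1) by (simp add: ell2_def)
  have small: "D i = 0" if "i < m + 1" for i
    using that assms(2) eps0 by (cases "i = 0") (auto simp: D_def left_half_eq glued_def)
  have large: "(D (i + (m + 1)))\<^sup>2 \<le> (if i < n then 2 * d\<^sup>2 else 0) + 2 * (\<epsilon> (i + (m + 1)))\<^sup>2" for i
  proof (cases "i + (m + 1) \<le> (n + 1) div 2")
    case True
    then have "D (i + (m + 1)) = d - \<epsilon> (i + (m + 1))" "i < n"
      using assms(2) by (auto simp: D_def left_half_eq glued_def)
    moreover have "(d - e)\<^sup>2 \<le> 2 * d\<^sup>2 + 2 * e\<^sup>2" for e
      using sum_squares_bound[of d "- e"] by (simp add: power2_diff)
    ultimately show ?thesis by simp
  next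
    case False
    then have "D (i + (m + 1)) = - \<epsilon> (i + (m + 1))"
      by (simp add: D_def left_half_eq)
    then show ?thesis by simp
  qed
  have sums: "(\<lambda>i. (if i < n then 2 * d\<^sup>2 else 0)) sums (2 * (real n * d\<^sup>2))"
    using sums_finite[of "{..<n}" "\<lambda>i. (if i < n then 2 * d\<^sup>2 else 0)"]
    by (simp add: mult.left_commute)
  have sums2: "(\<lambda>i. 2 * (\<epsilon> (i + (m + 1)))\<^sup>2) sums (2 * tail_mass \<epsilon> (m + 1))"
    unfolding tail_mass_def by (intro sums_mult summable_sums summable_tail assms(1))
  note sums12 = sums_add[OF sums sums2]
  have summ: "summable (\<lambda>i. (D (i + (m + 1)))\<^sup>2)"
    by (rule summable_comparison_test'[OF sums_summable[OF sums12], where N = 0]) (use large in auto)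
  then have summD: "summable (\<lambda>i. (D i)\<^sup>2)"
    by (subst (asm) summable_iff_shift[of "\<lambda>i. (D i)\<^sup>2"])
  then show "D \<in> ell2" using small[of 0] by (simp add: ell2_def)
  have "ell2_inner D D = (\<Sum>i. (D (i + (m + 1)))\<^sup>2)"
    using suminf_minus_initial_segment[OF summD, of "m + 1"] small
    by (simp add: ell2_inner_def power2_eq_square)
  also have "\<dots> \<le> 2 * (real n * d\<^sup>2) + 2 * tail_mass \<epsilon> (m + 1)"
    unfolding sums_unique[OF sums12] by (rule suminf_le[OF large summ sums_summable[OF sums12]])
  finally show "ell2_inner D D \<le> 2 * (real n * d\<^sup>2) + 2 * tail_mass \<epsilon> (m + 1)" .
qed

section \<open>Square sums over windows\<close>

lemma window_square_le:
  fixes x :: "nat \<Rightarrow> real"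
  shows "(\<Sum>l=j+1..j+k. x l)\<^sup>2 \<le> real k * (\<Sum>l=j+1..j+k. (x l)\<^sup>2)"
  using Cauchy_Schwarz_ineq_sum[of x "\<lambda>_. 1" "{j+1..j+k}"] by (simp add: mult.commute)

text \<open>One factor \<open>k\<close> comes from Cauchy-Schwarz, the other from each site lying in
  at most \<open>k\<close> windows. Together they cancel the \<open>k\<^sup>2\<close> in the
  denominator of the bound on \<open>\<phi>\<close>.\<close>

lemma sum_window_squares_le:
  fixes x :: "nat \<Rightarrow> real"
  assumes "finite A" "finite B" "\<And>j. j \<in> A \<Longrightarrow> {j+1..j+k} \<subseteq> B"
  shows "(\<Sum>j\<in>A. (\<Sum>l=j+1..j+k. x l)\<^sup>2) \<le> (real k)\<^sup>2 * (\<Sum>l\<in>B. (x l)\<^sup>2)"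
proof -
  have "(\<Sum>j\<in>A. (\<Sum>l=j+1..j+k. x l)\<^sup>2) \<le> (\<Sum>j\<in>A. real k * (\<Sum>l=j+1..j+k. (x l)\<^sup>2))"
    by (intro sum_mono window_square_le)
  also have "\<dots> = real k * (\<Sum>j\<in>A. \<Sum>i=1..k. (x (j + i))\<^sup>2)"
  proof -
    have "(\<Sum>l=j+1..j+k. (x l)\<^sup>2) = (\<Sum>i=1..k. (x (j + i))\<^sup>2)" for j
      by (rule sum.reindex_bij_witness[of _ "\<lambda>i. j + i" "\<lambda>l. l - j"]) auto
    then show ?thesis by (simp add: sum_distrib_left)
  qed
  also have "(\<Sum>j\<in>A. \<Sum>i=1..k. (x (j + i))\<^sup>2) = (\<Sum>i=1..k. \<Sum>j\<in>A. (x (j + i))\<^sup>2)"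
    by (rule sum.swap)
  also have "\<dots> \<le> (\<Sum>i=1..k. \<Sum>l\<in>B. (x l)\<^sup>2)"
  proof (rule sum_mono)
    fix i assume i: "i \<in> {1..k}"
    have "(\<Sum>j\<in>A. (x (j + i))\<^sup>2) = (\<Sum>l\<in>(\<lambda>j. j + i) ` A. (x l)\<^sup>2)"
      by (subst sum.reindex) auto
    also have "\<dots> \<le> (\<Sum>l\<in>B. (x l)\<^sup>2)"
      by (rule sum_mono2) (use assms i in \<open>force+\<close>)
    finally show "(\<Sum>j\<in>A. (x (j + i))\<^sup>2) \<le> (\<Sum>l\<in>B. (x l)\<^sup>2)" .
  qed
  also have "\<dots> = real k * (\<Sum>l\<in>B. (x l)\<^sup>2)" by simp
  finally show ?thesis by (simp add: power2_eq_square mult.assoc mult_left_mono)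
qed

context
  fixes V :: "real \<Rightarrow> ereal"
  assumes adm: "admissible_potential V"
begin

text \<open>These windows give finitely many terms of a double series with nonnegative
  terms.\<close>

lemma boundary_windows_le:
  assumes ge: "\<And>i. i \<ge> 1 \<Longrightarrow> - 1 \<le> x i" and m: "m \<le> n"
  shows "(\<Sum>k=1..n. \<Sum>j | j + k \<le> m. \<phi> V k (\<Sum>l=j+1..j+k. x l))
    \<le> (\<Sum>k. \<Sum>j. \<phi> V (Suc k) (\<Sum>l=j+1..Suc k+j. x l))"
proof -
  let ?f = "\<lambda>k j. \<phi> V (Suc k) (\<Sum>l=j+1..Suc k+j. x l)"
  have nonneg: "0 \<le> ?f k j" for k j by (rule E_inf_term_nonneg[OF adm ge])
  have "(\<Sum>k=1..n. \<Sum>j | j + k \<le> m. \<phi> V k (\<Sum>l=j+1..j+k. x l)) = (\<Sum>k<n. \<Sum>j | j + Suc k \<le> m. ?f k j)"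
    by (rule sum.reindex_bij_witness[of _ Suc "\<lambda>k. k - 1"]) (auto simp: add.commute intro!: sum.cong)
  also have "\<dots> \<le> (\<Sum>k<n. \<Sum>j<n. ?f k j)"
    using nonneg m by (intro sum_mono sum_mono2) auto
  also have "\<dots> \<le> (\<Sum>k. \<Sum>j. ?f k j)"
    unfolding suminf_suminf_ereal_eq_SUP[of ?f, OF nonneg] by (rule SUP_upper) simp
  finally show ?thesis .
qed

text \<open>Windows inside one of the two boundary layers see \<open>\<epsilon>\<close> or \<open>\<eta>\<close> only. All other windows
  of length \<open>k\<close> lie in \<open>{p..n+1-p}\<close> with \<open>p = m + 2 - k\<close>, where little mass is left.\<close>

lemma glued_phi_sum_le:
  fixes \<epsilon> \<eta> :: "nat \<Rightarrow> real" and d :: real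
  assumes \<epsilon>: "\<epsilon> \<in> ell2" "\<And>i. i \<ge> 1 \<Longrightarrow> - 1 \<le> \<epsilon> i" and \<eta>: "\<eta> \<in> ell2" "\<And>i. i \<ge> 1 \<Longrightarrow> - 1 \<le> \<eta> i"
    and m: "2 * m \<le> n"
    and w: "\<And>k. 0 \<le> w k"
      "\<And>k y. k \<ge> 1 \<Longrightarrow> y \<ge> - real k / 2 \<Longrightarrow> \<phi> V k y \<le> ereal (w k * (y / real k)\<^sup>2)"
  defines "M \<equiv> \<lambda>k. tail_mass \<epsilon> (max 1 (m + 2 - k)) + tail_mass \<eta> (max 1 (m + 2 - k)) + real n * d\<^sup>2"
  assumes M: "\<And>k. k \<ge> 1 \<Longrightarrow> M k \<le> real k / 4"
  shows "(\<Sum>k=1..n. \<Sum>j=0..n-k. \<phi> V k (\<Sum>l=j+1..j+k. glued \<epsilon> \<eta> m n d l))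
    \<le> (\<Sum>k. \<Sum>j. \<phi> V (Suc k) (\<Sum>l=j+1..Suc k+j. \<epsilon> l))
      + (\<Sum>k. \<Sum>j. \<phi> V (Suc k) (\<Sum>l=j+1..Suc k+j. \<eta> l))
      + ereal (\<Sum>k=1..n. w k * M k)"
proof -
  let ?g = "glued \<epsilon> \<eta> m n d"
  let ?W = "\<lambda>k j. \<phi> V k (\<Sum>l=j+1..j+k. ?g l)"
  have "(\<Sum>j=0..n-k. ?W k j) \<le> (\<Sum>j | j + k \<le> m. \<phi> V k (\<Sum>l=j+1..j+k. \<epsilon> l))
      + (\<Sum>j | j + k \<le> m. \<phi> V k (\<Sum>l=j+1..j+k. \<eta> l)) + ereal (w k * M k)"
    if k: "k \<in> {1..n}" for k
  proof -
    define p where "p = max 1 (m + 2 - k)"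
    define A where "A = {j \<in> {0..n-k}. \<not> j + k \<le> m \<and> \<not> n - m \<le> j}"
    let ?B = "{j. j + k \<le> m}" and ?r = "\<lambda>j. n - k - j"
    have fin: "finite ?B" by (rule finite_subset[of _ "{..m}"]) auto
    \<comment> \<open>A window not contained in \<open>{1..m}\<close> ends at \<open>m + 1\<close>
      or later, hence starts at \<open>m + 2 - k\<close> or later; the right end is symmetric. The
      maximum with \<open>1\<close> handles windows longer than \<open>m\<close>.\<close>
    have sub: "{j+1..j+k} \<subseteq> {p..n+1-p}" if "j \<in> A" for j
      using that k m by (auto simp: A_def p_def)
    have mass: "(\<Sum>l=p..n+1-p. (?g l)\<^sup>2) \<le> M k"
      unfolding M_def p_def by (rule glued_mass) (use \<epsilon> \<eta> in auto)
    have bulk: "(\<Sum>j\<in>A. ?W k j) \<le> ereal (w k * M k)"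
    proof -
      have "?W k j \<le> ereal (w k * ((\<Sum>l=j+1..j+k. ?g l) / real k)\<^sup>2)" if j: "j \<in> A" for j
      proof (rule w(2))
        have "(\<Sum>l=j+1..j+k. ?g l)\<^sup>2 \<le> real k * (\<Sum>l=j+1..j+k. (?g l)\<^sup>2)"
          by (rule window_square_le)
        also have "\<dots> \<le> real k * (\<Sum>l=p..n+1-p. (?g l)\<^sup>2)"
          by (intro mult_left_mono sum_mono2 sub j) auto
        \<comment> \<open>The constant \<open>1/4\<close> is chosen so that the window sum has
          absolute value at most \<open>k / 2\<close>, where the quadratic bound applies.\<close>
        also have "\<dots> \<le> real k * (real k / 4)"
          using mass M[of k] k by (intro mult_left_mono) auto
        also have "\<dots> = (real k / 2)\<^sup>2" by (simp add: power2_eq_square)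
        finally have "\<bar>\<Sum>l=j+1..j+k. ?g l\<bar> \<le> real k / 2"
          unfolding abs_le_square_iff[symmetric] by simp
        then show "- real k / 2 \<le> (\<Sum>l=j+1..j+k. ?g l)" by linarith
      qed (use k in auto)
      then have "(\<Sum>j\<in>A. ?W k j) \<le> (\<Sum>j\<in>A. ereal (w k * ((\<Sum>l=j+1..j+k. ?g l) / real k)\<^sup>2))"
        by (rule sum_mono)
      also have "\<dots> = ereal (w k * ((\<Sum>j\<in>A. (\<Sum>l=j+1..j+k. ?g l)\<^sup>2) / (real k)\<^sup>2))"
        by (subst sum_divide_distrib) (simp add: power_divide sum_distrib_left)
      also have "\<dots> \<le> ereal (w k * M k)"
      proof -
        have "(\<Sum>j\<in>A. (\<Sum>l=j+1..j+k. ?g l)\<^sup>2) \<le> (real k)\<^sup>2 * (\<Sum>l=p..n+1-p. (?g l)\<^sup>2)"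
          by (rule sum_window_squares_le) (use sub in \<open>auto simp: A_def\<close>)
        also have "\<dots> \<le> (real k)\<^sup>2 * M k" by (rule mult_left_mono[OF mass]) simp
        finally have "(\<Sum>j\<in>A. (\<Sum>l=j+1..j+k. ?g l)\<^sup>2) / (real k)\<^sup>2 \<le> M k"
          using k by (simp add: divide_le_eq mult.commute)
        then have "w k * ((\<Sum>j\<in>A. (\<Sum>l=j+1..j+k. ?g l)\<^sup>2) / (real k)\<^sup>2) \<le> w k * M k"
          by (rule mult_left_mono[OF _ w(1)])
        then show ?thesis by (simp only: ereal_less_eq)
      qed
      finally show ?thesis .
    qed
    have left: "(\<Sum>j\<in>?B. ?W k j) = (\<Sum>j\<in>?B. \<phi> V k (\<Sum>l=j+1..j+k. \<epsilon> l))"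
    proof (rule sum.cong[OF refl])
      fix j assume "j \<in> ?B"
      then have "(\<Sum>l=j+1..j+k. ?g l) = (\<Sum>l=j+1..j+k. \<epsilon> l)"
        using m by (intro sum.cong) (auto simp: glued_def)
      then show "?W k j = \<phi> V k (\<Sum>l=j+1..j+k. \<epsilon> l)" by simp
    qed
    have inj: "inj_on ?r ?B"
      using m by (auto simp: inj_on_def)
    have right: "(\<Sum>j\<in>?r ` ?B. ?W k j) = (\<Sum>j\<in>?B. \<phi> V k (\<Sum>l=j+1..j+k. \<eta> l))"
      unfolding sum.reindex[OF inj] o_def
    proof (rule sum.cong[OF refl])
      fix j assume j: "j \<in> ?B"
      have "(\<Sum>l=?r j+1..?r j+k. ?g l) = (\<Sum>l=j+1..j+k. ?g (n + 1 - l))"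
        by (rule window_reflect[symmetric]) (use j m in auto)
      also have "\<dots> = (\<Sum>l=j+1..j+k. \<eta> l)"
        by (rule sum.cong) (use j m in \<open>auto simp: glued_def\<close>)
      finally show "?W k (?r j) = \<phi> V k (\<Sum>l=j+1..j+k. \<eta> l)" by simp
    qed
    have "{0..n-k} = ?B \<union> ?r ` ?B \<union> A"
    proof (intro equalityI subsetI)
      fix j assume j: "j \<in> {0..n-k}"
      show "j \<in> ?B \<union> ?r ` ?B \<union> A"
      proof (cases "n - m \<le> j")
        case True
        then have "j = ?r (n - k - j)" "n - k - j \<in> ?B" using j k m by auto
        then show ?thesis by blast
      qed (use j in \<open>auto simp: A_def\<close>)
    qed (use m in \<open>auto simp: A_def\<close>)
    then have "(\<Sum>j=0..n-k. ?W k j) = (\<Sum>j\<in>?B \<union> ?r ` ?B \<union> A. ?W k j)" by simp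
    also have "\<dots> = (\<Sum>j\<in>?B \<union> ?r ` ?B. ?W k j) + (\<Sum>j\<in>A. ?W k j)"
      by (rule sum.union_disjoint) (use fin k m in \<open>auto simp: A_def\<close>)
    also have "(\<Sum>j\<in>?B \<union> ?r ` ?B. ?W k j) = (\<Sum>j\<in>?B. ?W k j) + (\<Sum>j\<in>?r ` ?B. ?W k j)"
      by (rule sum.union_disjoint) (use fin k m in auto)
    finally show ?thesis
      unfolding left right using bulk by (simp add: add_left_mono)
  qed
  then have "(\<Sum>k=1..n. \<Sum>j=0..n-k. ?W k j)
      \<le> (\<Sum>k=1..n. (\<Sum>j | j + k \<le> m. \<phi> V k (\<Sum>l=j+1..j+k. \<epsilon> l))
      + (\<Sum>j | j + k \<le> m. \<phi> V k (\<Sum>l=j+1..j+k. \<eta> l)) + ereal (w k * M k))"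
    by (rule sum_mono)
  also have "\<dots> = (\<Sum>k=1..n. \<Sum>j | j + k \<le> m. \<phi> V k (\<Sum>l=j+1..j+k. \<epsilon> l))
      + (\<Sum>k=1..n. \<Sum>j | j + k \<le> m. \<phi> V k (\<Sum>l=j+1..j+k. \<eta> l)) + (\<Sum>k=1..n. ereal (w k * M k))"
    by (simp only: sum.distrib)
  also have "\<dots> \<le> (\<Sum>k. \<Sum>j. \<phi> V (Suc k) (\<Sum>l=j+1..Suc k+j. \<epsilon> l))
      + (\<Sum>k. \<Sum>j. \<phi> V (Suc k) (\<Sum>l=j+1..Suc k+j. \<eta> l)) + (\<Sum>k=1..n. ereal (w k * M k))"
    using m by (intro add_mono order_refl boundary_windows_le \<epsilon>(2) \<eta>(2)) auto
  finally show ?thesis by simp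
qed

end

section \<open>Strong convergence of the glued sequences\<close>

lemma strong_conv_inner_tendsto:
  assumes "strong_conv Y y" "x \<in> ell2" "y \<in> ell2" "\<And>n. Y n \<in> ell2"
  shows "(\<lambda>n. ell2_inner x (Y n)) \<longlonglongrightarrow> ell2_inner x y"
proof -
  let ?D = "\<lambda>n i. Y n i - y i"
  have D: "?D n \<in> ell2" for n
  proof -
    have "summable (\<lambda>i. Y n i * Y n i - 2 * (Y n i * y i) + y i * y i)"
      by (intro summable_add summable_diff summable_mult ell2_summable_mult assms)
    then have "summable (\<lambda>i. (?D n i)\<^sup>2)"
      by (simp add: power2_eq_square algebra_simps)
    then show ?thesis using assms(3,4) by (simp add: ell2_def)
  qed
  have "(\<lambda>n. ell2_inner x (?D n)) \<longlonglongrightarrow> 0"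
  proof (rule Lim_null_comparison)
    show "\<forall>\<^sub>F n in sequentially. norm (ell2_inner x (?D n)) \<le> sqrt (ell2_inner x x) * ell2_norm (?D n)"
      using ell2_Cauchy_Schwarz[OF assms(2) D] by (simp add: ell2_norm_def)
    show "(\<lambda>n. sqrt (ell2_inner x x) * ell2_norm (?D n)) \<longlonglongrightarrow> 0"
      using assms(1) unfolding strong_conv_def by (rule tendsto_mult_right_zero)
  qed
  moreover have "ell2_inner x (?D n) = ell2_inner x (Y n) - ell2_inner x y" for n
    unfolding ell2_inner_def right_diff_distrib
    by (intro suminf_diff[symmetric] ell2_summable_mult assms)
  ultimately show ?thesis by (simp add: LIM_zero_iff)
qed

lemma glued_strong_conv:
  assumes \<epsilon>: "\<epsilon> \<in> ell2" and m: "\<forall>\<^sub>F n in sequentially. 2 * m n \<le> n" "filterlim m at_top sequentially"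
    and q: "(\<lambda>n. real n * (d n)\<^sup>2) \<longlonglongrightarrow> 0"
  shows "strong_conv (\<lambda>n. left_half n (glued \<epsilon> \<eta> (m n) n (d n))) \<epsilon>"
proof -
  let ?D = "\<lambda>n i. left_half n (glued \<epsilon> \<eta> (m n) n (d n)) i - \<epsilon> i"
  let ?b = "\<lambda>n. 2 * (real n * (d n)\<^sup>2) + 2 * tail_mass \<epsilon> (m n + 1)"
  have "filterlim (\<lambda>n. m n + 1) at_top sequentially"
    by (rule filterlim_at_top_mono[OF m(2)]) auto
  then have "(\<lambda>n. tail_mass \<epsilon> (m n + 1)) \<longlonglongrightarrow> 0"
    by (rule filterlim_compose[OF tail_mass_tendsto_0[OF \<epsilon>]])
  then have "?b \<longlonglongrightarrow> 2 * 0 + 2 * 0"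
    by (intro tendsto_intros q)
  then have b: "?b \<longlonglongrightarrow> 0" by simp
  have "(\<lambda>n. ell2_inner (?D n) (?D n)) \<longlonglongrightarrow> 0"
  proof (rule tendsto_sandwich[OF _ _ tendsto_const b])
    show "\<forall>\<^sub>F n in sequentially. 0 \<le> ell2_inner (?D n) (?D n)"
      using m(1) by eventually_elim (rule ell2_inner_self_nonneg, rule glued_left_half_diff(1)[OF \<epsilon>])
    show "\<forall>\<^sub>F n in sequentially. ell2_inner (?D n) (?D n) \<le> ?b n"
      using m(1) by eventually_elim (rule glued_left_half_diff(2)[OF \<epsilon>])
  qed
  then have "(\<lambda>n. sqrt (ell2_inner (?D n) (?D n))) \<longlonglongrightarrow> sqrt 0"
    by (rule tendsto_real_sqrt)
  then show ?thesis by (simp add: strong_conv_def ell2_norm_def)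
qed

lemma right_half_glued:
  assumes "2 * m \<le> n"
  shows "right_half n (glued \<epsilon> \<eta> m n d) = left_half n (glued \<eta> \<epsilon> m n d)"
proof
  fix i
  have "glued \<epsilon> \<eta> m n d (n + 1 - i) = glued \<eta> \<epsilon> m n d i" if "1 \<le> i" "i \<le> (n + 1) div 2"
    using that by (intro glued_reflect assms) auto
  then show "right_half n (glued \<epsilon> \<eta> m n d) i = left_half n (glued \<eta> \<epsilon> m n d) i"
    by (simp add: right_half_eq left_half_eq)
qed

lemma strong_conv_cong:
  assumes "\<forall>\<^sub>F n in sequentially. X n = Y n"
  shows "strong_conv X x \<longleftrightarrow> strong_conv Y x"
  unfolding strong_conv_def using assms by (intro tendsto_cong) (auto elim!: eventually_mono)

text \<open>Partial sums grow at most like \<open>sqrt p\<close>, which bounds the total to be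
  compensated in the middle.\<close>

lemma ell2_partial_sum_square_le:
  assumes "\<epsilon> \<in> ell2" "\<eta> \<in> ell2"
  shows "(\<Sum>i=1..p. \<epsilon> i + \<eta> i)\<^sup>2 \<le> 2 * real p * (ell2_inner \<epsilon> \<epsilon> + ell2_inner \<eta> \<eta>)"
proof -
  have "(\<Sum>i=1..p. \<epsilon> i + \<eta> i)\<^sup>2 \<le> (\<Sum>i=1..p. (\<epsilon> i + \<eta> i)\<^sup>2) * real p"
    using Cauchy_Schwarz_ineq_sum[of "\<lambda>i. \<epsilon> i + \<eta> i" "\<lambda>_. 1" "{1..p}"] by simp
  also have "(\<Sum>i=1..p. (\<epsilon> i + \<eta> i)\<^sup>2) \<le> (\<Sum>i=1..p. 2 * (\<epsilon> i)\<^sup>2 + 2 * (\<eta> i)\<^sup>2)"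
  proof (rule sum_mono)
    show "(\<epsilon> i + \<eta> i)\<^sup>2 \<le> 2 * (\<epsilon> i)\<^sup>2 + 2 * (\<eta> i)\<^sup>2" for i
      using sum_squares_bound[of "\<epsilon> i" "\<eta> i"] by (simp add: power2_sum)
  qed
  also have "\<dots> = 2 * ((\<Sum>i=1..p. (\<epsilon> i)\<^sup>2) + (\<Sum>i=1..p. (\<eta> i)\<^sup>2))"
    by (simp add: sum.distrib sum_distrib_left)
  also have "\<dots> \<le> 2 * (ell2_inner \<epsilon> \<epsilon> + ell2_inner \<eta> \<eta>)"
    using assms by (intro mult_left_mono add_mono sum_le_ell2_inner) auto
  finally show ?thesis by (simp add: mult_right_mono algebra_simps)
qed

lemma filterlim_floor_sqrt: "filterlim floor_sqrt at_top sequentially"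
  unfolding filterlim_at_top
proof
  fix Z
  show "\<forall>\<^sub>F n in sequentially. Z \<le> floor_sqrt n"
    using eventually_ge_at_top[of "Z\<^sup>2"] by eventually_elim (rule le_floor_sqrtI)
qed

context
  fixes V :: "real \<Rightarrow> ereal"
  assumes adm: "admissible_potential V"
begin

text \<open>The first \<open>m\<close> entries of \<open>\<epsilon>\<close> and of \<open>\<eta>\<close> are kept, where \<open>m\<^sup>2 \<le> n\<close>. Their sum is of order
  \<open>sqrt m\<close>, and compensating it evenly on the remaining sites costs \<open>\<ell>\<^sup>2\<close> mass of order \<open>m / n\<close>.\<close>

lemma recovery_sequence:
  assumes dom: "(\<epsilon>, \<eta>) \<in> Dom_E_inf"
  shows "\<exists>X. (\<forall>n\<ge>1. X n \<in> Dom_E n) \<and> strong_conv2 X (\<epsilon>, \<eta>) \<and>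
    limsup (\<lambda>n. E V n (X n)) \<le> E_inf V (\<epsilon>, \<eta>)"
proof -
  have \<epsilon>: "\<epsilon> \<in> ell2" "\<And>i. i \<ge> 1 \<Longrightarrow> - 1 \<le> \<epsilon> i" and \<eta>: "\<eta> \<in> ell2" "\<And>i. i \<ge> 1 \<Longrightarrow> - 1 \<le> \<eta> i"
    using dom by (auto simp: Dom_E_inf_def)
  define T where "T = ell2_inner \<epsilon> \<epsilon> + ell2_inner \<eta> \<eta>"
  define m where "m = floor_sqrt"
  define S where "S = (\<lambda>p. \<Sum>i=1..p. \<epsilon> i + \<eta> i)"
  \<comment> \<open>By \<open>glued_sum\<close> this value makes the total vanish.\<close>
  define d where "d = (\<lambda>n. - S (m n) / real (n - 2 * m n))"
  define q where "q = (\<lambda>n. real n * (d n)\<^sup>2)"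
  define Y where "Y = (\<lambda>n. glued \<epsilon> \<eta> (m n) n (d n))"
  \<comment> \<open>For small \<open>n\<close> the glued sequence may be inadmissible; the zero
    configuration lies in every \<open>Dom_E n\<close>.\<close>
  define X where "X = (\<lambda>n. if Y n \<in> Dom_E n then Y n else (\<lambda>_. 0))"
  have T: "0 \<le> T" "ell2_inner \<epsilon> \<epsilon> \<le> T" "ell2_inner \<eta> \<eta> \<le> T"
    using ell2_inner_self_nonneg[OF \<epsilon>(1)] ell2_inner_self_nonneg[OF \<eta>(1)] by (auto simp: T_def)
  have m_lim: "filterlim m at_top sequentially"
    unfolding m_def by (rule filterlim_floor_sqrt)
  have m_sq: "m n * m n \<le> n" for n
    unfolding m_def using floor_sqrt_power2_le[of n] by (simp add: power2_eq_square)
  \<comment> \<open>From \<open>16\<close> on, \<open>m n \<ge> 4\<close>, so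
    \<open>4 * m n \<le> m n * m n \<le> n\<close>, and at least half of the sites lie in the
    middle.\<close>
  have m4: "1 \<le> m n" "4 * m n \<le> n" if "n \<ge> 16" for n
  proof -
    have "4 \<le> m n" unfolding m_def using that by (intro le_floor_sqrtI) simp
    then have "4 * m n \<le> m n * m n" by (rule mult_right_mono) simp
    with m_sq[of n] \<open>4 \<le> m n\<close> show "1 \<le> m n" "4 * m n \<le> n" by linarith+
  qed
  have ev_m: "\<forall>\<^sub>F n in sequentially. 2 * m n \<le> n"
    using eventually_ge_at_top[of 16] by eventually_elim (use m4 in force)
  \<comment> \<open>In the constant, \<open>2\<close> comes from the bound on partial sums and
    \<open>4\<close> from \<open>n \<le> 2 * (n - 2 * m n)\<close>; the factor \<open>1 / m\<close>
    comes from \<open>m n * m n \<le> n\<close>.\<close>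
  have q_le: "q n \<le> 8 * T / real (m n)" if n: "n \<ge> 16" for n
  proof -
    let ?r = "real (n - 2 * m n)"
    have r: "?r > 0" "real n \<le> 2 * ?r" and mpos: "real (m n) > 0" using m4[OF n] by auto
    have "(S (m n))\<^sup>2 \<le> 2 * real (m n) * T"
      unfolding S_def T_def by (rule ell2_partial_sum_square_le[OF \<epsilon>(1) \<eta>(1)])
    then have "real n * real (m n) * (S (m n))\<^sup>2 \<le> real n * real (m n) * (2 * real (m n) * T)"
      by (intro mult_left_mono) auto
    also have "\<dots> = 2 * T * (real n * real (m n * m n))" by simp
    also have "\<dots> \<le> 2 * T * (real n * real n)"
      using m_sq[of n] T(1) by (intro mult_left_mono) (auto simp del: of_nat_mult)
    also have "\<dots> \<le> 2 * T * ((2 * ?r) * (2 * ?r))"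
      using r T(1) by (intro mult_left_mono mult_mono) auto
    finally have "real n * real (m n) * (S (m n))\<^sup>2 \<le> 8 * T * ?r\<^sup>2"
      by (simp add: power2_eq_square)
    then show ?thesis
      unfolding q_def d_def using r(1) mpos by (simp add: power_divide field_simps)
  qed
  have q_lim: "q \<longlonglongrightarrow> 0"
  proof (rule tendsto_sandwich)
    show "\<forall>\<^sub>F n in sequentially. 0 \<le> q n" by (simp add: q_def)
    show "\<forall>\<^sub>F n in sequentially. q n \<le> 8 * T / real (m n)"
      using eventually_ge_at_top[of 16] by eventually_elim (rule q_le)
    show "(\<lambda>n. 8 * T / real (m n)) \<longlonglongrightarrow> 0"
      by (intro tendsto_divide_0[OF tendsto_const] filterlim_at_top_imp_at_infinity
          filterlim_compose[OF filterlim_real_sequentially m_lim])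
  qed simp
  obtain Q where Q: "\<And>n. \<bar>q n\<bar> \<le> Q"
    using convergent_imp_Bseq[of q] q_lim by (auto simp: convergent_def Bseq_def)
  have Q0: "0 \<le> Q" using Q[of 0] by linarith

  \<comment> \<open>This secures the upper constraint \<open>n\<close> in
    \<open>Dom_E\<close>.\<close>
  have entry_le: "x i \<le> real n" if "x \<in> ell2" "ell2_inner x x \<le> T" "T \<le> real n" "n \<ge> 1" for x i n
  proof -
    have "(x i)\<^sup>2 \<le> ell2_inner x x" using sum_le_ell2_inner[OF that(1), of "{i}"] by simp
    also have "\<dots> \<le> real n" using that by simp
    also have "\<dots> \<le> (real n)\<^sup>2" using that(4) by (intro self_le_power) auto
    finally show ?thesis by (rule power2_le_imp_le) simp
  qed
  have "\<forall>\<^sub>F n in sequentially. q n < 1" using q_lim by (rule order_tendstoD(2)) simp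
  moreover have "\<forall>\<^sub>F n in sequentially. T \<le> real n"
    using filterlim_real_sequentially unfolding filterlim_at_top by blast
  ultimately have "\<forall>\<^sub>F n in sequentially. Y n \<in> Dom_E n"
    using eventually_ge_at_top[of 16]
  proof eventually_elim
    case (elim n)
    have mn: "2 * m n < n" using m4[OF elim(3)] by linarith
    have "(d n)\<^sup>2 * 1 \<le> (d n)\<^sup>2 * real n" using elim(3) by (intro mult_left_mono) auto
    then have "(d n)\<^sup>2 \<le> 1\<^sup>2" using elim(1) by (simp add: q_def mult.commute)
    then have "\<bar>d n\<bar> \<le> 1" unfolding abs_le_square_iff[symmetric] by simp
    then have d: "- 1 \<le> d n" "d n \<le> real n" using elim(3) by auto
    have "Y n i \<in> {-1..real n}" if "i \<in> {1..n}" for i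
      using d \<epsilon> \<eta> that entry_le[OF \<epsilon>(1) T(2) elim(2)] entry_le[OF \<eta>(1) T(3) elim(2)] elim(3)
      by (auto simp: Y_def glued_def)
    moreover have "(\<Sum>i=1..n. Y n i) = 0"
    proof -
      have "(\<Sum>i=1..n. Y n i) = S (m n) + real (n - 2 * m n) * d n"
        unfolding Y_def S_def using mn by (intro glued_sum) simp
      moreover have "s + r * (- s / r) = 0" if "r \<noteq> 0" for r s :: real using that by simp
      moreover have "real (n - 2 * m n) \<noteq> 0" using mn by simp
      ultimately show ?thesis unfolding d_def by metis
    qed
    moreover have "Y n \<in> ell2" unfolding Y_def by (rule glued_ell2)
    ultimately show ?case by (auto simp: Dom_E_def Y_def glued_def)
  qed
  then have ev_X: "\<forall>\<^sub>F n in sequentially. Y n \<in> Dom_E n \<and> X n = Y n"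
    by eventually_elim (simp add: X_def)

  have q_lim': "(\<lambda>n. real n * (d n)\<^sup>2) \<longlonglongrightarrow> 0" using q_lim by (simp only: q_def)
  have L: "strong_conv (\<lambda>n. left_half n (Y n)) \<epsilon>"
    unfolding Y_def by (rule glued_strong_conv[OF \<epsilon>(1) ev_m m_lim q_lim'])
  have R: "strong_conv (\<lambda>n. right_half n (Y n)) \<eta>"
  proof (subst strong_conv_cong)
    show "\<forall>\<^sub>F n in sequentially. right_half n (Y n) = left_half n (glued \<eta> \<epsilon> (m n) n (d n))"
      using ev_m by eventually_elim (simp add: Y_def right_half_glued)
  qed (rule glued_strong_conv[OF \<eta>(1) ev_m m_lim q_lim'])

  obtain \<delta> where \<delta>: "\<delta> \<longlonglongrightarrow> 0" "\<And>n x. x \<in> Dom_E n \<Longrightarrow>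
      \<bar>(\<Sum>l=1..n. sigma_n V n l * x l)
        - (ell2_inner (\<sigma>_inf V) (left_half n x) + ell2_inner (\<sigma>_inf V) (right_half n x))\<bar>
      \<le> \<delta> n * sqrt (ell2_inner x x)"
    using linear_part_approx[OF adm] by blast
  let ?s = "ell2_inner (\<sigma>_inf V) (\<lambda>i. \<epsilon> i + \<eta> i)"
  let ?lin = "\<lambda>n. \<Sum>l=1..n. sigma_n V n l * Y n l"
  let ?h = "\<lambda>n. ell2_inner (\<sigma>_inf V) (left_half n (Y n)) + ell2_inner (\<sigma>_inf V) (right_half n (Y n))"
  have tail_0: "tail_mass x p \<le> ell2_inner x x" if "x \<in> ell2" for x p
    using tail_mass_antimono[OF that, of 0 p] by (simp add: tail_mass_def ell2_inner_def power2_eq_square)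
  have lin_lim: "?lin \<longlonglongrightarrow> ?s"
  proof -
    have "(\<lambda>n. ?lin n - ?h n) \<longlonglongrightarrow> 0"
    proof (rule Lim_null_comparison)
      show "\<forall>\<^sub>F n in sequentially. norm (?lin n - ?h n) \<le> \<bar>\<delta> n\<bar> * sqrt (T + Q)"
        using ev_X
      proof eventually_elim
        case (elim n)
        have "ell2_inner (Y n) (Y n) = (\<Sum>l=1..n+1-1. (Y n l)\<^sup>2)"
          using Dom_E_inner_self[of "Y n" n] elim by simp
        also have "\<dots> \<le> tail_mass \<epsilon> 1 + tail_mass \<eta> 1 + real n * (d n)\<^sup>2"
          unfolding Y_def by (rule glued_mass[OF \<epsilon>(1) \<eta>(1)]) simp
        also have "\<dots> \<le> T + Q"
          using tail_0[OF \<epsilon>(1), of 1] tail_0[OF \<eta>(1), of 1] Q[of n] by (simp add: T_def q_def)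
        finally have "\<delta> n * sqrt (ell2_inner (Y n) (Y n)) \<le> \<bar>\<delta> n\<bar> * sqrt (T + Q)"
          using elim ell2_inner_self_nonneg[of "Y n"]
          by (intro mult_mono real_sqrt_le_mono) (auto simp: Dom_E_def)
        then show ?case using \<delta>(2)[of "Y n" n] elim by simp
      qed
      have "(\<lambda>n. \<bar>\<delta> n\<bar> * sqrt (T + Q)) \<longlonglongrightarrow> \<bar>0\<bar> * sqrt (T + Q)"
        by (intro tendsto_intros \<delta>(1))
      then show "(\<lambda>n. \<bar>\<delta> n\<bar> * sqrt (T + Q)) \<longlonglongrightarrow> 0" by simp
    qed
    moreover have "?h \<longlonglongrightarrow> ?s"
      unfolding ell2_inner_sigma_inf_add[OF adm \<epsilon>(1) \<eta>(1)]
      by (intro tendsto_add strong_conv_inner_tendsto[OF L] strong_conv_inner_tendsto[OF R]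
          sigma_inf_ell2[OF adm] \<epsilon>(1) \<eta>(1)) (simp_all add: right_half_eq left_half_ell2)
    ultimately have "(\<lambda>n. (?lin n - ?h n) + ?h n) \<longlonglongrightarrow> 0 + ?s" by (rule tendsto_add)
    then show ?thesis by simp
  qed

  obtain w where w: "summable w" "\<And>k. 0 \<le> w k"
    "\<And>k y. k \<ge> 1 \<Longrightarrow> y \<ge> - real k / 2 \<Longrightarrow> \<phi> V k y \<le> ereal (w k * (y / real k)\<^sup>2)"
    using phi_upper_bound[OF adm] by blast
  define M where "M = (\<lambda>n k. tail_mass \<epsilon> (max 1 (m n + 2 - k)) + tail_mass \<eta> (max 1 (m n + 2 - k))
      + real n * (d n)\<^sup>2)"
  have M_le: "M n k \<le> T + Q" for n k
    using tail_0[OF \<epsilon>(1), of "max 1 (m n + 2 - k)"] tail_0[OF \<eta>(1), of "max 1 (m n + 2 - k)"] Q[of n]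
    by (simp add: M_def T_def q_def)
  have tail_nonneg: "0 \<le> tail_mass x p" if "x \<in> ell2" for x p
    unfolding tail_mass_def by (intro suminf_nonneg summable_tail that) simp
  have M_nonneg: "0 \<le> M n k" for n k
    unfolding M_def by (intro add_nonneg_nonneg tail_nonneg \<epsilon>(1) \<eta>(1)) auto
  have M_mono: "M n k \<le> M n k'" if "k \<le> k'" for n k k'
    unfolding M_def by (intro add_mono order_refl tail_mass_antimono \<epsilon>(1) \<eta>(1)) (use that in auto)
  have M_lim: "(\<lambda>n. M n k) \<longlonglongrightarrow> 0" for k
  proof -
    have "filterlim (\<lambda>n. max 1 (m n + 2 - k)) at_top sequentially"
      unfolding filterlim_at_top
    proof
      fix Z
      have "\<forall>\<^sub>F n in sequentially. Z + k \<le> m n"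
        using m_lim unfolding filterlim_at_top by blast
      then show "\<forall>\<^sub>F n in sequentially. Z \<le> max 1 (m n + 2 - k)"
        by eventually_elim auto
    qed
    then have "(\<lambda>n. M n k) \<longlonglongrightarrow> 0 + 0 + 0"
      unfolding M_def using \<epsilon>(1) \<eta>(1)
      by (intro tendsto_add q_lim' filterlim_compose[OF tail_mass_tendsto_0])
    then show ?thesis by simp
  qed
  \<comment> \<open>Above \<open>K\<close> the uniform bound \<open>T + Q\<close> is already small
    compared with \<open>k\<close>. Up to \<open>K\<close>, monotonicity in \<open>k\<close> reduces
    the claim to the limit at the single index \<open>K\<close>.\<close>
  have ev_M: "\<forall>\<^sub>F n in sequentially. \<forall>k\<ge>1. M n k \<le> real k / 4"
  proof -
    define K where "K = nat \<lceil>4 * (T + Q)\<rceil>"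
    have "\<forall>\<^sub>F n in sequentially. M n K < 1 / 4" by (rule order_tendstoD(2)[OF M_lim]) simp
    then show ?thesis
    proof eventually_elim
      case (elim n)
      show ?case
      proof (intro allI impI)
        fix k :: nat assume k: "k \<ge> 1"
        show "M n k \<le> real k / 4"
        proof (cases "k \<le> K")
          case True
          have "M n k \<le> 1 / 4" using M_mono[OF True, of n] elim by linarith
          moreover have "1 \<le> real k" using k by simp
          ultimately show ?thesis by linarith
        next
          case False
          then have "4 * (T + Q) \<le> real k" unfolding K_def by linarith
          then have "T + Q \<le> real k / 4" by simp
          with M_le show ?thesis by (rule order_trans)
        qed
      qed
    qed
  qed
  have w_bound: "norm (w k * M n k) \<le> w k * (T + Q)" for k n
    using w(2)[of k] M_le[of n k] M_nonneg[of n k] by (simp add: mult_left_mono)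
  have w_summable: "summable (\<lambda>k. w k * (T + Q))" by (intro summable_mult2 w(1))
  \<comment> \<open>\<open>M n k\<close> tends to \<open>0\<close> only for fixed \<open>k\<close>,
    since long windows reach into the layers; summability of \<open>w\<close> turns this into
    convergence of the whole sum.\<close>
  let ?rem = "\<lambda>n. \<Sum>k. w k * M n k"
  have rem_lim: "?rem \<longlonglongrightarrow> 0"
  proof -
    have "?rem \<longlonglongrightarrow> (\<Sum>k. w k * 0)"
    proof (rule tannerys_theorem[THEN conjunct2, THEN conjunct2])
      show "(\<lambda>n. w k * M n k) \<longlonglongrightarrow> w k * 0" for k by (intro tendsto_intros M_lim)
      show "\<forall>\<^sub>F (k, n) in sequentially \<times>\<^sub>F sequentially. norm (w k * M n k) \<le> w k * (T + Q)"
        using w_bound by (intro always_eventually) blast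
    qed (use w_summable in auto)
    then show ?thesis by simp
  qed

  let ?A = "\<Sum>k. \<Sum>j. \<phi> V (Suc k) (\<Sum>l=j+1..Suc k+j. \<epsilon> l)"
  let ?B = "\<Sum>k. \<Sum>j. \<phi> V (Suc k) (\<Sum>l=j+1..Suc k+j. \<eta> l)"
  have "\<forall>\<^sub>F n in sequentially. E V n (X n) \<le> ?A + ?B + ereal (?rem n + ?lin n)"
    using ev_X ev_M ev_m
  proof eventually_elim
    case (elim n)
    have "(\<Sum>k=1..n. w k * M n k) \<le> ?rem n"
      using w(2) M_nonneg
      by (intro sum_le_suminf summable_comparison_test'[OF w_summable w_bound]) auto
    moreover have "(\<Sum>k=1..n. \<Sum>j=0..n-k. \<phi> V k (\<Sum>l=j+1..j+k. Y n l))
        \<le> ?A + ?B + ereal (\<Sum>k=1..n. w k * M n k)"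
      unfolding Y_def M_def
      by (rule glued_phi_sum_le[OF adm \<epsilon> \<eta> elim(3) w(2,3)]) (use elim(2) in \<open>auto simp: M_def\<close>)
    ultimately have "(\<Sum>k=1..n. \<Sum>j=0..n-k. \<phi> V k (\<Sum>l=j+1..j+k. Y n l)) \<le> ?A + ?B + ereal (?rem n)"
      by (meson add_left_mono ereal_less_eq(3) order_trans)
    then have "E V n (Y n) \<le> ?A + ?B + ereal (?rem n) + ereal (?lin n)"
      using elim(1) by (simp only: E_eq[OF adm]) (rule add_right_mono)
    then show ?case using elim(1) by (simp add: add.assoc)
  qed
  then have "limsup (\<lambda>n. E V n (X n)) \<le> limsup (\<lambda>n. ?A + ?B + ereal (?rem n + ?lin n))"
    by (rule Limsup_mono)
  also have "\<dots> = ?A + ?B + ereal ?s"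
  proof (rule lim_imp_Limsup)
    have "0 \<le> ?A" "0 \<le> ?B"
      by (intro suminf_0_le E_inf_term_nonneg[OF adm] \<epsilon>(2) \<eta>(2); assumption)+
    then have "?A + ?B \<noteq> - \<infinity>" by auto
    moreover have "(\<lambda>n. ereal (?rem n + ?lin n)) \<longlonglongrightarrow> ereal (0 + ?s)"
      by (intro tendsto_ereal tendsto_add rem_lim lin_lim)
    ultimately show "(\<lambda>n. ?A + ?B + ereal (?rem n + ?lin n)) \<longlonglongrightarrow> ?A + ?B + ereal ?s"
      by (intro tendsto_add_ereal_nonneg tendsto_const) auto
  qed simp
  finally have "limsup (\<lambda>n. E V n (X n)) \<le> E_inf V (\<epsilon>, \<eta>)"
    by (simp add: E_inf_def)
  moreover have "\<forall>n\<ge>1. X n \<in> Dom_E n"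
    by (auto simp: X_def Dom_E_def ell2_def)
  moreover have "strong_conv (\<lambda>n. left_half n (X n)) \<epsilon>"
  proof (subst strong_conv_cong)
    show "\<forall>\<^sub>F n in sequentially. left_half n (X n) = left_half n (Y n)"
      using ev_X by eventually_elim simp
  qed (rule L)
  moreover have "strong_conv (\<lambda>n. right_half n (X n)) \<eta>"
  proof (subst strong_conv_cong)
    show "\<forall>\<^sub>F n in sequentially. right_half n (X n) = right_half n (Y n)"
      using ev_X by eventually_elim simp
  qed (rule R)
  ultimately show ?thesis unfolding strong_conv2_def by auto
qed

end

theorem theorem4p3:
  fixes V :: "real \<Rightarrow> ereal"
  assumes "admissible_potential V"
  shows
    "(\<forall>X :: nat \<Rightarrow> nat \<Rightarrow> real.
        (\<forall>n\<ge>1. X n \<in> ell2) \<and> (\<exists>C::real. \<forall>n\<ge>1. \<bar>E V n (X n)\<bar> \<le> ereal C)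
        \<longrightarrow> (\<exists>C::real. \<forall>n\<ge>1. ell2_norm (X n) \<le> C)) \<and>
     (\<forall>\<epsilon> \<eta>. (\<epsilon>, \<eta>) \<in> Dom_E_inf \<longrightarrow>
        (\<forall>X. (\<forall>n\<ge>1. X n \<in> Dom_E n) \<and> weak_conv2 X (\<epsilon>, \<eta>)
           \<longrightarrow> liminf (\<lambda>n. E V n (X n)) \<ge> E_inf V (\<epsilon>, \<eta>)) \<and>
        (\<exists>X. (\<forall>n\<ge>1. X n \<in> Dom_E n) \<and> strong_conv2 X (\<epsilon>, \<eta>) \<and>
           limsup (\<lambda>n. E V n (X n)) \<le> E_inf V (\<epsilon>, \<eta>)))"
proof (intro conjI allI impI)
  fix X :: "nat \<Rightarrow> nat \<Rightarrow> real"
  assume "(\<forall>n\<ge>1. X n \<in> ell2) \<and> (\<exists>C::real. \<forall>n\<ge>1. \<bar>E V n (X n)\<bar> \<le> ereal C)"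
  then obtain C where C: "\<And>n. n \<ge> 1 \<Longrightarrow> \<bar>E V n (X n)\<bar> \<le> ereal C" by blast
  obtain R where R: "\<And>C n x. x \<in> Dom_E n \<Longrightarrow> E V n x \<le> ereal C \<Longrightarrow> ell2_inner x x \<le> R C"
    using E_bounded_imp_inner_bounded[OF assms] by blast
  have "ell2_norm (X n) \<le> sqrt (R C)" if n: "n \<ge> 1" for n
  proof -
    have dom: "X n \<in> Dom_E n"
    proof (rule ccontr)
      \<comment> \<open>Outside \<open>Dom_E n\<close> the energy is \<open>\<infinity>\<close>,
        which contradicts the bound.\<close>
      assume "X n \<notin> Dom_E n"
      then show False using C[OF n] by (simp add: E_def)
    qed
    have "E V n (X n) \<le> \<bar>E V n (X n)\<bar>" by (cases "E V n (X n)") auto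
    then have "E V n (X n) \<le> ereal C" using C[OF n] by (rule order_trans)
    then show ?thesis using R[OF dom] by (simp add: ell2_norm_def)
  qed
  then show "\<exists>C::real. \<forall>n\<ge>1. ell2_norm (X n) \<le> C" by blast
qed (use liminf_inequality[OF assms] recovery_sequence[OF assms] in blast)+

end
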